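(* For integers $m,j,n\ge 0$ let $Q_{m,j}(n)$ denote the number of pairs $(\mu,\lambda)$ whose parts sum in total to $n$, where $\mu$ is an overpartition into even parts, each $\le 2m$, with exactly $j$ parts, and $\lambda$ is a partition into odd parts, each $\le 2m+1$, such that (i) every odd positive integer $<2m+1$ appears as a part of $\lambda$, and it appears an even number of times; (ii) the part $2m+1$ may repeat any number of times or not appear at all. Then, for $0<|q|<1$, $$\sum_{m,n,j\ge0}(-1)^jQ_{m,j}(n)q^n= \frac{1}{2}\sum_{n\ge0}q^{3n^2/2}(1+q^{2n+1})(1+q^{n+1/2})\sum_{|j|\le n}q^{j^2/2}+\frac{1}{2}\sum_{n\ge0}(-1)^nq^{3n^2/2}(1+q^{2n+1})(1-q^{n+1/2})\sum_{|j|\le n}(-1)^jq^{j^2/2}.$$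
   Context: An overpartition is a partition in which the first occurrence of each part size may be overlined (or not); the number of parts counts both overlined and non-overlined parts. Empty partitions and overpartitions are allowed where consistent with the conditions. Here $q\in\mathbb{C}$ with $0<|q|<1$, and $q^{1/2}$ is a fixed square root of $q$ (half-integer powers of $q$ are powers of $q^{1/2}$). On the right-hand side, $\sum_{|j|\le n}$ runs over all integers $j$ with $-n\le j\le n$; this $j$ is a dummy index unrelated to the $j$ on the left-hand side. *)

theory Defs
  imports "HOL-Analysis.Analysis" "HOL-Library.Multiset"
begin

definition is_partition :: "nat multiset \<Rightarrow> bool" where
  "is_partition P \<longleftrightarrow> 0 \<notin># P"

(* An overpartition is encoded as a pair (P, S): P is the multiset of all part sizes,
   overlined parts included, and S is the set of those part sizes whose first
   occurrence is overlined. *)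
definition is_overpartition :: "nat multiset \<times> nat set \<Rightarrow> bool" where
  "is_overpartition \<mu> \<longleftrightarrow> is_partition (fst \<mu>) \<and> snd \<mu> \<subseteq> set_mset (fst \<mu>)"

definition Q_pairs :: "nat \<Rightarrow> nat \<Rightarrow> nat \<Rightarrow> ((nat multiset \<times> nat set) \<times> nat multiset) set" where
  "Q_pairs m j n = {(\<mu>, L).
     is_overpartition \<mu> \<and>
     (\<forall>k \<in># fst \<mu>. even k \<and> k \<le> 2 * m) \<and>
     size (fst \<mu>) = j \<and>
     is_partition L \<and>
     (\<forall>k \<in># L. odd k \<and> k \<le> 2 * m + 1) \<and>
     (\<forall>k. odd k \<and> k < 2 * m + 1 \<longrightarrow> k \<in># L \<and> even (count L k)) \<and>
     sum_mset (fst \<mu>) + sum_mset L = n}"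

definition Q :: "nat \<Rightarrow> nat \<Rightarrow> nat \<Rightarrow> nat" where
  "Q m j n = card (Q_pairs m j n)"

lemma finite_partitions_sum_le: "finite {P. is_partition P \<and> sum_mset P \<le> n}"
proof -
  have *: "size P \<le> sum_mset P" if "0 \<notin># P" for P :: "nat multiset"
    using that by (induction P) auto
  have "P \<in> mset ` {xs. set xs \<subseteq> {..n} \<and> length xs \<le> n}"
    if "is_partition P" "sum_mset P \<le> n" for P
  proof -
    obtain xs where xs: "P = mset xs" by (metis ex_mset)
    have "size P \<le> n" using *[of P] that by (simp add: is_partition_def)
    moreover have "k \<le> n" if "k \<in># P" for k
      using multi_member_split[OF that] \<open>sum_mset P \<le> n\<close> by auto
    ultimately show ?thesis using xs by auto
  qed
  then have "{P. is_partition P \<and> sum_mset P \<le> n} \<subseteq> mset ` {xs. set xs \<subseteq> {..n} \<and> length xs \<le> n}"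
    by blast
  then show ?thesis
    by (rule finite_subset) (rule finite_imageI, rule finite_lists_length_le, rule finite_atMost)
qed

lemma finite_Q_pairs: "finite (Q_pairs m j n)"
proof -
  let ?A = "{P. is_partition P \<and> sum_mset P \<le> n}"
  have "Q_pairs m j n \<subseteq> (SIGMA P:?A. Pow (set_mset P)) \<times> ?A"
    by (auto simp: Q_pairs_def is_overpartition_def)
  then show ?thesis
    by (rule finite_subset) (intro finite_cartesian_product finite_SigmaI finite_partitions_sum_le; simp)
qed

(* In the two series below, s stands for the fixed square root of q, so that q to the
   power k/2 is s ^ k (or s powi k for an integer k). *)
definition rhs_term1 :: "complex \<Rightarrow> complex \<Rightarrow> nat \<Rightarrow> complex" where
  "rhs_term1 q s n = s ^ (3 * n\<^sup>2) * (1 + q ^ (2 * n + 1)) * (1 + s ^ (2 * n + 1)) *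
     (\<Sum>j\<in>{- int n..int n}. s powi (j\<^sup>2))"

definition rhs_term2 :: "complex \<Rightarrow> complex \<Rightarrow> nat \<Rightarrow> complex" where
  "rhs_term2 q s n = (-1) ^ n * s ^ (3 * n\<^sup>2) * (1 + q ^ (2 * n + 1)) * (1 - s ^ (2 * n + 1)) *
     (\<Sum>j\<in>{- int n..int n}. (-1) powi j * s powi (j\<^sup>2))"

end

(* With x = q^2 = s^4 and P n = (1 - x) ... (1 - x^n), summing over the multiplicities of the parts
   turns the left-hand side into
     sum_m x^(m^2) (1 + q x^m) P(m)^2 / P(2m+1).
   Put w(a) = (-1)^a x^(a(a-1)/2) and let E(N) be the sum of w(a) w(b) over a + b = N, taken with sign
   + over a, b >= 0 and with sign - over a, b < 0. Since E(N+2) = x^N E(N) + 2 w(N+2) and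
   E(N) + E(2-N) = 2 w(N) - 2 w(N-1), the sums of E(N) [2m+1, m-N] and of x^N E(N) [2m+1, m-N] over N
   have the closed forms (-1)^m x^(m(m-1)/2) P(m) and x^m times that: a Bailey pair. Expanding
   P(m) on the left by it and exchanging the summations, the sum over m is evaluated by a
   telescoping argument (a limiting case of the q-Gauss sum), and what remains is a single sum
   over r of (-1)^r x^(r(r+1)/2) (E(r) + E(-1-r) + q (x^r E(r) + x^(-1-r) E(-1-r))). As
   a^2 + ab + b^2 = (3(a+b)^2 + (a-b)^2)/4, its r-th term is the mean of the r-th terms of the two series on the right,
   the inner index j being a - b. *)
theory Submission
  imports Defs
begin

section \<open>A Hecke-type Bailey pair\<close>

locale punctured_disc =
  fixes x :: complex
  assumes nz: "x \<noteq> 0" and lt1: "norm x < 1"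
begin

definition qpoch :: "nat \<Rightarrow> complex" where
  "qpoch n = (\<Prod>i<n. 1 - x ^ Suc i)"

text \<open>The Gaussian binomial coefficient. The value 0 for \<open>k > n\<close> keeps the Pascal
  rule true at its boundary and lets a sum over a row run one index too far.\<close>

definition qbin :: "nat \<Rightarrow> nat \<Rightarrow> complex" where
  "qbin n k = (if k \<le> n then qpoch n / (qpoch k * qpoch (n - k)) else 0)"

text \<open>The terms of a theta series. \<open>N * (N - 1)\<close> is even and nonnegative, so the
  halving is exact and the exponent of \<open>x\<close> is never negative.\<close>

definition w :: "int \<Rightarrow> complex" where
  "w N = (-1) powi N * x powi (N * (N - 1) div 2)"

text \<open>\<open>E N\<close> is the Hecke-type sum of \<open>w a * w b\<close> over \<open>a + b = N\<close>, where pairs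
  \<open>a, b \<ge> 0\<close> count with sign \<open>+\<close> and pairs \<open>a, b < 0\<close> with sign \<open>-\<close>.\<close>

definition E :: "int \<Rightarrow> complex" where
  "E N = (if N \<ge> 0 then \<Sum>a\<in>{0..N}. w a * w (N - a) else - (\<Sum>a\<in>{N+1..-1}. w a * w (N - a)))"

text \<open>At \<open>n = 2 * m + 1\<close>, \<open>k = int m\<close> this is, up to the factor
  \<open>qpoch (2 * m + 1)\<close>, the sum defining a Bailey pair relative to \<open>x\<close>;
  \<open>conv_fold\<close> brings it to that shape.\<close>

definition conv :: "(int \<Rightarrow> complex) \<Rightarrow> nat \<Rightarrow> int \<Rightarrow> complex" where
  "conv f n k = (\<Sum>i\<le>n. f (k - int i) * qbin n i)"

section \<open>q-factorials and the q-Pascal rule\<close>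

lemma one_minus_power_nz: "1 - x ^ Suc n \<noteq> 0"
proof
  assume "1 - x ^ Suc n = 0"
  then have "norm x ^ Suc n = 1"
    by (metis eq_iff_diff_eq_0 norm_one norm_power)
  then show False
    using nz lt1 power_Suc_less_one[of "norm x" n] by simp
qed

lemma qpoch_0 [simp]: "qpoch 0 = 1"
  by (simp add: qpoch_def)

lemma qpoch_Suc: "qpoch (Suc n) = qpoch n * (1 - x ^ Suc n)"
  by (simp add: qpoch_def)

lemma qpoch_nz [simp]: "qpoch n \<noteq> 0"
  using one_minus_power_nz by (auto simp: qpoch_def)

lemma qbin_0 [simp]: "qbin n 0 = 1"
  by (simp add: qbin_def)

lemma qbin_sym: "k \<le> n \<Longrightarrow> qbin n (n - k) = qbin n k"
  by (simp add: qbin_def mult.commute)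

lemma qbin_Suc_Suc:
  assumes "k \<le> n"
  shows "qbin (Suc n) (Suc k) = qbin n (Suc k) + x ^ (n - k) * qbin n k"
proof (cases "k = n")
  case False
  then obtain d where n: "n = Suc (k + d)"
    using assms by (metis less_imp_Suc_add le_neq_implies_less)
  \<comment> \<open>Over a common denominator this is 1 - uv = (1 - v) + v(1 - u).\<close>
  have frac: "z * (1 - u * v) / (a * (1 - u) * (b * (1 - v))) =
      z / (a * (1 - u) * b) + v * (z / (a * (b * (1 - v))))"
    if "a \<noteq> 0" "b \<noteq> 0" "1 - u \<noteq> 0" "1 - v \<noteq> 0" for z u v a b :: complex
    using that by (simp add: divide_simps) algebra
  have "x ^ Suc n = x ^ Suc k * x ^ Suc d" and [simp]: "Suc (k + d) - k = Suc d"
    by (simp_all add: n power_add)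
  then show ?thesis
    using frac[of "qpoch k" "qpoch d" "x ^ Suc k" "x ^ Suc d" "qpoch n"]
      one_minus_power_nz[of k] one_minus_power_nz[of d]
    by (simp add: qbin_def qpoch_Suc n del: power_Suc)
qed (simp add: qbin_def)

section \<open>Shift and reflection laws of \<open>w\<close> and of the Hecke-type sums
  \<open>E\<close>\<close>

lemma w_add_one: "w (N + 1) = - (x powi N) * w N"
proof -
  have e: "even (N * (N - 1))"
    by auto
  then have "(N + 1) * N div 2 = N * (N - 1) div 2 + N"
    by (auto elim!: evenE simp: algebra_simps)
  then show ?thesis
    using nz by (simp add: w_def power_int_add)
qed

lemma w_reflect: "w (1 - N) = - w N"
proof -
  have "(1 - N) * (1 - N - 1) = N * (N - 1)" by (simp add: algebra_simps)
  moreover have "(-1) powi (1 - N) = - ((-1) powi N :: complex)"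
    by (simp add: power_int_diff power_int_minus_left)
  ultimately show ?thesis by (simp only: w_def) simp
qed

lemma w_0 [simp]: "w 0 = 1" and w_1 [simp]: "w 1 = -1"
  by (simp_all add: w_def)

lemma w_shift2: "w (a + 1) * w (b + 1) = x powi (a + b) * (w a * w b)"
  using nz by (simp add: w_add_one power_int_add)

text \<open>Raising both indices of a pair by 1 multiplies its weight by x^N. For N >= 0 the shift
  misses the two pairs with a zero entry, each of weight \<open>w (N + 2)\<close>. For N <= -3 two
  pairs leave the negative quadrant by acquiring a zero entry, and the minus sign in
  \<open>E\<close> yields the same correction.\<close>

lemma E_add_two: "E (N + 2) = x powi N * E N + 2 * w (N + 2)"
proof -
  consider "N \<ge> 0" | "N = -1" | "N = -2" | "N \<le> -3" by linarith
  then show ?thesis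
  proof cases
    case 1
    have ends: "{0..N+2} = insert 0 (insert (N+2) {1..N+1})" using 1 by auto
    have "(\<Sum>a\<in>{1..N+1}. w a * w (N + 2 - a)) = (\<Sum>a\<in>{0..N}. w (a + 1) * w (N - a + 1))"
      by (rule sum.reindex_bij_witness[of _ "\<lambda>a. a + 1" "\<lambda>a. a - 1"]) (auto simp: algebra_simps)
    also have "\<dots> = x powi N * (\<Sum>a\<in>{0..N}. w a * w (N - a))"
      by (simp add: w_shift2 sum_distrib_left)
    finally show ?thesis using 1 by (simp add: E_def ends)
  next
    case 2
    have "{0..1::int} = {0, 1}" by auto
    then show ?thesis using 2 by (simp add: E_def)
  next
    case 3
    \<comment> \<open>The only pair (-1, -1) moves to (0, 0), so the two end pairs coincide and the
      sign changes; the values are compared directly.\<close>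
    have "- w (-1) = x" using w_add_one[of "-1"] nz by (simp add: power_int_minus field_simps)
    then have "w (-1) = - x" by (metis minus_minus)
    then show ?thesis using 3 nz by (simp add: E_def power_int_minus field_simps power2_eq_square)
  next
    case 4
    have ends: "{N+2..0} = insert 0 (insert (N+2) {N+3..-1})" using 4 by auto
    have "x powi N * (\<Sum>a\<in>{N+1..-1}. w a * w (N - a)) = (\<Sum>a\<in>{N+1..-1}. w (a + 1) * w (N - a + 1))"
      by (simp add: w_shift2 sum_distrib_left)
    also have "\<dots> = (\<Sum>a\<in>{N+2..0}. w a * w (N + 2 - a))"
      by (rule sum.reindex_bij_witness[of _ "\<lambda>a. a - 1" "\<lambda>a. a + 1"]) (auto simp: algebra_simps)
    also have "\<dots> = 2 * w (N + 2) + (\<Sum>a\<in>{N+3..-1}. w a * w (N + 2 - a))"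
      unfolding ends using 4 by simp
    finally show ?thesis using 4 by (simp add: E_def add.commute)
  qed
qed

lemma E_0 [simp]: "E 0 = 1"
  by (simp add: E_def)

lemma E_1 [simp]: "E 1 = -2"
  using E_add_two[of "-1"] by (simp add: E_def)

lemma E_minus_one [simp]: "E (-1) = 0"
  by (simp add: E_def)

text \<open>The defect \<open>D\<close> of the identity obeys the homogeneous recurrence D(N+2) =
  x^N D(N), because \<open>w_reflect\<close> cancels the inhomogeneous terms. It vanishes at 0 and
  1, hence for all N >= 0, and its symmetry under N -> 2 - N covers the negative N.\<close>

lemma E_reflect: "E N + E (2 - N) = 2 * w N - 2 * w (N - 1)"
proof -
  define D where "D N = E N + E (2 - N) - 2 * w N + 2 * w (N - 1)" for N
  have step: "D (N + 2) = x powi N * D N" for N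
  proof -
    have 1: "E (N + 2) = x powi N * E N + 2 * w (N + 2)" by (rule E_add_two)
    have 2: "E (2 - N) = x powi (-N) * E (-N) + 2 * w (2 - N)"
      using E_add_two[of "-N"] by (simp add: algebra_simps)
    have 3: "w (2 - N) = - w (N - 1)" using w_reflect[of "N - 1"] by simp
    have 4: "w (N + 1) = - (x powi N) * w N" by (rule w_add_one)
    have 5: "x powi N * x powi (-N) = 1" using nz by (simp add: power_int_minus)
    have "x powi N * E (2 - N) = E (- N) - 2 * x powi N * w (N - 1)"
    proof -
      have "x powi N * E (2 - N) = (x powi N * x powi (-N)) * E (- N) - 2 * x powi N * w (N - 1)"
        unfolding 2 3 by (simp add: right_diff_distrib mult.assoc)
      then show ?thesis unfolding 5 by simp
    qed
    moreover have "2 - (N + 2) = - N" "N + 2 - 1 = N + 1" by simp_all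
    ultimately show ?thesis unfolding D_def by (simp only: 1 4) (simp add: algebra_simps)
  qed
  have sym: "D (2 - N) = D N" for N
    using w_reflect[of N] w_reflect[of "N - 1"] by (simp add: D_def algebra_simps)
  have pos: "D (int n) = 0" for n
  proof (induction n rule: nat_less_induct)
    case (1 n)
    have D1: "D 1 = 0" by (simp add: D_def)
    have "E 2 = 1 + 2 * w 2" using E_add_two[of 0] by simp
    then have D0: "D 0 = 0"
      using w_reflect[of 2] by (simp add: D_def)
    consider "n = 0" | "n = 1" | k where "n = k + 2"
      by (metis One_nat_def add_2_eq_Suc' not0_implies_Suc)
    then show ?case
      using D0 D1 1 step[of "int (n - 2)"] by cases (auto simp: add.commute)
  qed
  have "D N = 0"
    using pos[of "nat N"] pos[of "nat (2 - N)"] sym[of N] by (cases "N \<ge> 0") auto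
  then show ?thesis by (simp add: D_def algebra_simps)
qed

section \<open>Convolution with rows of Gaussian binomials\<close>

lemma conv_Suc:
  "conv f (Suc n) k = conv f n k + x powi (int n - k + 1) * conv (\<lambda>N. x powi N * f N) n (k - 1)"
proof -
  have "conv f (Suc n) k = f k + (\<Sum>i\<le>n. f (k - 1 - int i) * (qbin n (Suc i) + x ^ (n - i) * qbin n i))"
    unfolding conv_def by (subst sum.atMost_Suc_shift) (simp add: qbin_Suc_Suc algebra_simps)
  also have "\<dots> = (f k + (\<Sum>i\<le>n. f (k - 1 - int i) * qbin n (Suc i))) +
      (\<Sum>i\<le>n. f (k - 1 - int i) * x ^ (n - i) * qbin n i)"
    by (simp add: algebra_simps sum.distrib)
  also have "f k + (\<Sum>i\<le>n. f (k - 1 - int i) * qbin n (Suc i)) = (\<Sum>i\<le>Suc n. f (k - int i) * qbin n i)"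
    by (subst sum.atMost_Suc_shift) (simp add: algebra_simps)
  also have "\<dots> = conv f n k"
    by (simp add: conv_def qbin_def)
  also have "(\<Sum>i\<le>n. f (k - 1 - int i) * x ^ (n - i) * qbin n i) =
      x powi (int n - k + 1) * conv (\<lambda>N. x powi N * f N) n (k - 1)"
    unfolding conv_def sum_distrib_left
  proof (rule sum.cong)
    fix i assume "i \<in> {..n}"
    \<comment> \<open>The Pascal weight is split into a factor free of \<open>i\<close> and a power
      of \<open>x\<close> whose exponent is exactly the argument of \<open>f\<close>.\<close>
    then have "x ^ (n - i) = x powi ((int n - k + 1) + (k - 1 - int i))"
      by (simp add: power_int_def nat_diff_distrib)
    also have "\<dots> = x powi (int n - k + 1) * x powi (k - 1 - int i)"
      using nz by (intro power_int_add) simp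
    finally have "x ^ (n - i) = \<dots>" .
    then show "f (k - 1 - int i) * x ^ (n - i) * qbin n i =
        x powi (int n - k + 1) * (x powi (k - 1 - int i) * f (k - 1 - int i) * qbin n i)"
      by simp
  qed simp
  finally show ?thesis .
qed

text \<open>Multiplying \<open>w\<close> by \<open>x powi N\<close> amounts to a shift with a sign,
  so the Pascal step only contributes a factor; iterated, this is the finite q-binomial
  theorem.\<close>

lemma conv_w_Suc: "conv w (Suc n) k = (1 - x powi (int n - k + 1)) * conv w n k"
proof -
  have "x powi N * w N = - w (N + 1)" for N by (simp add: w_add_one)
  then have "conv (\<lambda>N. x powi N * w N) n (k - 1) = - conv w n k"
    by (simp add: conv_def sum_negf)
  then show ?thesis by (simp add: conv_Suc algebra_simps)
qed

text \<open>Passing from row k - 1 to row k contributes the factor 1 - x^0, and every later row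
  inherits the zero.\<close>

lemma conv_w_eq_0:
  assumes "1 \<le> k" "k \<le> int n"
  shows "conv w n k = 0"
  using assms
proof (induction n)
  case (Suc n)
  then show ?case by (cases "k = int (Suc n)") (simp_all add: conv_w_Suc)
qed simp

text \<open>Trading the power of \<open>x\<close> for a shift by two makes the Pascal recurrence for
  \<open>conv E\<close> close up to values of \<open>conv w\<close>.\<close>

lemma conv_power_E: "conv (\<lambda>N. x powi N * E N) n k = conv E n (k + 2) - 2 * conv w n (k + 2)"
proof -
  have eq: "(\<lambda>N. x powi N * E N) = (\<lambda>N. E (N + 2) - 2 * w (N + 2))"
    by (simp add: E_add_two)
  show ?thesis
    unfolding eq by (simp add: conv_def sum_subtractf sum_distrib_left algebra_simps)
qed

lemma conv_flip: "conv f n k = (\<Sum>i\<le>n. f (k - int n + int i) * qbin n i)"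
  unfolding conv_def
  by (rule sum.reindex_bij_witness[of _ "\<lambda>i. n - i" "\<lambda>i. n - i"])
    (auto simp: qbin_sym of_nat_diff algebra_simps)

text \<open>Reversing the row leaves the Gaussian binomials unchanged, and \<open>E_reflect\<close>
  then folds the reversed arguments back.\<close>

lemma conv_E_reflect:
  "conv E n k = - conv E n (int n + 2 - k) + 2 * conv w n k - 2 * conv w n (k - 1)"
proof -
  have eq: "E (k - int n + int i) = - E (int n + 2 - k - int i) + 2 * w (k - int n + int i) -
      2 * w (k - 1 - int n + int i)" for i
    using E_reflect[of "k - int n + int i"] by (simp add: algebra_simps)
  have "conv E n k = (\<Sum>i\<le>n. - (E (int n + 2 - k - int i) * qbin n i) +
      2 * (w (k - int n + int i) * qbin n i) - 2 * (w (k - 1 - int n + int i) * qbin n i))"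
    unfolding conv_flip[of E] eq by (simp add: algebra_simps)
  then show ?thesis
    unfolding conv_flip[of w]
    by (simp add: conv_def sum.distrib sum_subtractf sum_distrib_left sum_negf)
qed

text \<open>The Pascal rule together with \<open>E (N + 2) = x powi N * E N + \<dots>\<close> relates the rows \<open>n\<close> and \<open>n + 1\<close>
  of \<open>conv E\<close>; the antisymmetry \<open>k \<mapsto> n + 2 - k\<close> of a row makes the central entries of an
  even row vanish, which closes a two-step recurrence. All boundary terms are values of
  \<open>conv w\<close> inside the range where it is zero.\<close>

lemma conv_E_middle:
  shows "conv E (2 * m + 1) (int m) = (-1) ^ m * x ^ (m choose 2) * qpoch m" (is ?A)
    and "conv E (2 * m + 1) (int m + 1) = - (x ^ m * conv E (2 * m + 1) (int m))" (is ?B)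
proof -
  let ?L = "\<lambda>m. conv E (2 * m + 1) (int m)"
  let ?M = "\<lambda>m. conv E (2 * m + 1) (int m + 1)"
  have rec: "conv E (Suc n) k = conv E n k + x powi (int n - k + 1) * (conv E n (k + 1) - 2 * conv w n (k + 1))" for n k
    using conv_Suc[of E n k] conv_power_E[of n "k - 1"] by (simp add: add.commute)
  have L: "?L m = conv E (2 * m) (int m)" and M: "?M m = - (x ^ m * conv E (2 * m) (int m))"
    if "m \<ge> 1" for m
  proof -
    have W: "conv w (2 * m) (int m) = 0" "conv w (2 * m) (int m + 1) = 0"
      using that by (auto intro!: conv_w_eq_0)
    have z: "conv E (2 * m) (int m + 1) = 0"
      using conv_E_reflect[of "2 * m" "int m + 1"] W by simp
    show "?L m = conv E (2 * m) (int m)"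
      using rec[of "2 * m" "int m"] z W by simp
    have "conv E (2 * m) (int m + 2) - 2 * conv w (2 * m) (int m + 2) = - conv E (2 * m) (int m)"
      using conv_E_reflect[of "2 * m" "int m + 2"] W by (simp add: algebra_simps)
    then show "?M m = - (x ^ m * conv E (2 * m) (int m))"
      using rec[of "2 * m" "int m + 1"] z by (simp add: add.assoc)
  qed
  \<comment> \<open>For m = 0 the entry \<open>conv w 0 0 = w 0 = 1\<close> lies outside the
    vanishing range, so row 1 is evaluated directly.\<close>
  have base: "?L 0 = 1" "?M 0 = -1"
    by (simp_all add: conv_def qbin_def)
  have B: "?M m = - (x ^ m * ?L m)" for m
    using L[of m] M[of m] base by (cases "m = 0") (simp_all del: of_nat_0)
  then show ?B .
  have step: "?L (Suc m) = (1 - x ^ Suc m) * ?M m" for m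
  proof -
    have "conv w (2 * m + 1) (int m + 1) = 0"
      by (auto intro!: conv_w_eq_0)
    then have "conv E (2 * m + 1) (int m + 2) - 2 * conv w (2 * m + 1) (int m + 2) = - ?M m"
      using conv_E_reflect[of "2 * m + 1" "int m + 2"] by (simp add: algebra_simps)
    moreover have "x powi (int (2 * m + 1) - (int m + 1) + 1) = x ^ Suc m"
      by (simp add: power_int_def nat_add_distrib)
    ultimately have "conv E (Suc (2 * m + 1)) (int m + 1) = (1 - x ^ Suc m) * ?M m"
      using rec[of "2 * m + 1" "int m + 1"] by (simp add: add.assoc left_diff_distrib)
    then show ?thesis using L[of "Suc m"] by (simp add: add.commute)
  qed
  show ?A
  proof (induction m)
    case (Suc m)
    have "Suc m choose 2 = m + (m choose 2)" by (simp add: numeral_2_eq_2)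
    then have "x ^ (Suc m choose 2) = x ^ m * x ^ (m choose 2)" by (simp add: power_add)
    then show ?case unfolding step B Suc qpoch_Suc
      by (simp add: power_Suc[of "-1"] ac_simps del: power_Suc)
  qed (use base in \<open>simp add: binomial_eq_0\<close>)
qed

text \<open>The second Bailey pair. The shift by two leads to position m + 2, which reflection in
  row 2m + 1 exchanges with m + 1, where \<open>conv_E_middle\<close> gives the value.\<close>

lemma conv_power_E_middle:
  "conv (\<lambda>N. x powi N * E N) (2 * m + 1) (int m) = x ^ m * conv E (2 * m + 1) (int m)"
proof -
  have "conv w (2 * m + 1) (int m + 1) = 0"
    by (auto intro!: conv_w_eq_0)
  then have "conv E (2 * m + 1) (int m + 2) - 2 * conv w (2 * m + 1) (int m + 2) =
      - conv E (2 * m + 1) (int m + 1)"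
    using conv_E_reflect[of "2 * m + 1" "int m + 2"] by (simp add: algebra_simps)
  then show ?thesis
    using conv_E_middle(2)[of m] by (simp add: conv_power_E)
qed

text \<open>The row has the even length 2m + 2. Entries i and 2m + 1 - i carry the same coefficient,
  and with r = m - i their arguments are r and -1 - r.\<close>

lemma conv_fold:
  "conv f (2 * m + 1) (int m) = (\<Sum>r\<le>m. (f (int r) + f (-1 - int r)) * qbin (2 * m + 1) (m - r))"
proof -
  have "{..2*m+1} = {..m} \<union> {m+1..2*m+1}" by auto
  then have "conv f (2 * m + 1) (int m) = (\<Sum>i\<le>m. f (int m - int i) * qbin (2 * m + 1) i) +
      (\<Sum>i\<in>{m+1..2*m+1}. f (int m - int i) * qbin (2 * m + 1) i)"
    unfolding conv_def by (simp only:) (rule sum.union_disjoint, auto)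
  also have "(\<Sum>i\<le>m. f (int m - int i) * qbin (2 * m + 1) i) =
      (\<Sum>r\<le>m. f (int r) * qbin (2 * m + 1) (m - r))"
    by (rule sum.reindex_bij_witness[of _ "\<lambda>i. m - i" "\<lambda>i. m - i"]) (auto simp: of_nat_diff)
  also have "(\<Sum>i\<in>{m+1..2*m+1}. f (int m - int i) * qbin (2 * m + 1) i) =
      (\<Sum>r\<le>m. f (-1 - int r) * qbin (2 * m + 1) (m - r))"
  proof (rule sum.reindex_bij_witness[of _ "\<lambda>r. m + 1 + r" "\<lambda>i. i - (m + 1)"])
    fix i assume i: "i \<in> {m+1..2*m+1}"
    have "2 * m + 1 - i = m - (i - (m + 1))" using i by auto
    then have "qbin (2 * m + 1) (m - (i - (m + 1))) = qbin (2 * m + 1) i"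
      using qbin_sym[of i "2 * m + 1"] i by auto
    moreover have "-1 - int (i - (m + 1)) = int m - int i" using i by auto
    ultimately show "f (-1 - int (i - (m + 1))) * qbin (2 * m + 1) (m - (i - (m + 1))) =
        f (int m - int i) * qbin (2 * m + 1) i"
      by simp
  qed auto
  finally show ?thesis by (simp add: sum.distrib algebra_simps)
qed

end

section \<open>Exchanging the summations\<close>

lemma Suc_choose_two: "Suc n choose 2 = n + (n choose 2)"
  by (simp add: numeral_2_eq_2)

lemma choose_two_add: "(Suc n choose 2) + (n choose 2) = n\<^sup>2"
  by (induction n) (simp_all add: Suc_choose_two power2_eq_square binomial_eq_0)

text \<open>The ratio of consecutive terms, \<open>C * r ^ Suc m\<close>, tends to 0. This is the
  common majorant for the convergence arguments: a triangular exponent beats any geometric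
  growth.\<close>

lemma summable_power_triangular:
  fixes C r :: real
  assumes "0 \<le> C" "0 \<le> r" "r < 1"
  shows "summable (\<lambda>m. C ^ m * r ^ (Suc m choose 2))"
proof -
  have "(\<lambda>m. C * r ^ Suc m) \<longlonglongrightarrow> C * 0"
    using assms by (intro tendsto_mult tendsto_const LIMSEQ_Suc LIMSEQ_power_zero) simp
  then have "eventually (\<lambda>m. C * r ^ Suc m < 1 / 2) sequentially"
    by (intro order_tendstoD) auto
  then obtain N where N: "C * r ^ Suc m < 1 / 2" if "m \<ge> N" for m
    by (auto simp: eventually_sequentially)
  show ?thesis
  proof (rule summable_ratio_test[of "1 / 2" N])
    fix m assume "N \<le> m"
    then have "(C * r ^ Suc m) * (C ^ m * r ^ (Suc m choose 2)) \<le> 1 / 2 * (C ^ m * r ^ (Suc m choose 2))"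
      using N[of m] assms by (intro mult_right_mono) auto
    moreover have "C ^ Suc m * r ^ (Suc (Suc m) choose 2) = (C * r ^ Suc m) * (C ^ m * r ^ (Suc m choose 2))"
      by (simp only: Suc_choose_two[of "Suc m"] power_add power_Suc ac_simps)
    ultimately show "norm (C ^ Suc m * r ^ (Suc (Suc m) choose 2)) \<le> 1 / 2 * norm (C ^ m * r ^ (Suc m choose 2))"
      using assms by (simp only: real_norm_def abs_mult power_abs abs_of_nonneg)
  qed simp
qed

context punctured_disc
begin

section \<open>Bounds for q-factorials and the conjugate Bailey pair\<close>

definition K :: real where "K = 1 / (1 - norm x)"

lemma K_ge_1: "1 \<le> K"
  using lt1 nz by (simp add: K_def)

lemma norm_qpoch_le: "norm (qpoch n) \<le> 2 ^ n"
proof (induction n)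
  case (Suc n)
  have "norm (1 - x ^ Suc n) \<le> norm (1::complex) + norm (x ^ Suc n)" by (rule norm_triangle_ineq4)
  also have "\<dots> \<le> 2"
    using power_le_one[of "norm x" "Suc n"] lt1 by (simp add: norm_power del: power_Suc)
  finally have "norm (qpoch n) * norm (1 - x ^ Suc n) \<le> 2 ^ n * 2"
    using Suc by (intro mult_mono) auto
  then show ?case by (simp add: qpoch_Suc norm_mult mult.commute del: power_Suc) simp
qed simp

lemma norm_inverse_qpoch_le: "norm (1 / qpoch n) \<le> K ^ n"
proof (induction n)
  case (Suc n)
  have "1 - norm x \<le> norm (1::complex) - norm (x ^ Suc n)"
    using power_le_one[of "norm x" n] lt1
    by (simp add: norm_mult norm_power mult_left_le)
  also have "\<dots> \<le> norm (1 - x ^ Suc n)" by (rule norm_triangle_ineq2)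
  finally have "1 / norm (1 - x ^ Suc n) \<le> K"
    using lt1 by (auto simp: K_def intro!: divide_left_mono mult_pos_pos simp del: power_Suc)
  then have "norm (1 / qpoch n) * (1 / norm (1 - x ^ Suc n)) \<le> K ^ n * K"
    using Suc K_ge_1 by (intro mult_mono) auto
  then show ?case by (simp add: qpoch_Suc norm_mult norm_divide mult.commute del: power_Suc) simp
qed simp

text \<open>Terms of the conjugate Bailey pair with delta_m = (-1)^m x^(m(m+1)/2)
  \<open>qpoch m\<close>. The value 0 for r > m extends the triangular double sum to all pairs of
  indices.\<close>

definition tau :: "nat \<Rightarrow> nat \<Rightarrow> complex" where
  "tau m r = (if r \<le> m then (-1) ^ m * x ^ (Suc m choose 2) * qpoch m / (qpoch (m - r) * qpoch (m + r + 1)) else 0)"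

lemma norm_tau_le: "norm (tau m r) \<le> K * ((2 * K\<^sup>2) ^ m * norm x ^ (Suc m choose 2))"
proof (cases "r \<le> m")
  case True
  have "norm (tau m r) = norm x ^ (Suc m choose 2) * norm (qpoch m) *
      (norm (1 / qpoch (m - r)) * norm (1 / qpoch (m + r + 1)))"
    using True by (simp add: tau_def norm_mult norm_divide norm_power)
  also have "\<dots> \<le> norm x ^ (Suc m choose 2) * 2 ^ m * (K ^ (m - r) * K ^ (m + r + 1))"
    using K_ge_1 by (intro mult_mono norm_qpoch_le norm_inverse_qpoch_le order_refl) auto
  also have "K ^ (m - r) * K ^ (m + r + 1) = K * (K\<^sup>2) ^ m"
    using True by (simp add: mult_2 flip: power_add power_mult power_Suc)
  finally show ?thesis by (simp add: power_mult_distrib ac_simps)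
qed (use K_ge_1 in \<open>simp add: tau_def\<close>)

lemma tau_tendsto_0: "(\<lambda>m. tau m r) \<longlonglongrightarrow> 0"
proof (rule Lim_null_comparison)
  show "eventually (\<lambda>m. norm (tau m r) \<le> K * ((2 * K\<^sup>2) ^ m * norm x ^ (Suc m choose 2))) sequentially"
    by (intro always_eventually allI norm_tau_le)
  have "(\<lambda>m. (2 * K\<^sup>2) ^ m * norm x ^ (Suc m choose 2)) \<longlonglongrightarrow> 0"
    by (intro summable_LIMSEQ_zero summable_power_triangular) (use lt1 in auto)
  then show "(\<lambda>m. K * ((2 * K\<^sup>2) ^ m * norm x ^ (Suc m choose 2))) \<longlonglongrightarrow> 0"
    by (rule tendsto_mult_right_zero)
qed

text \<open>\<open>G\<close> is a WZ certificate: summed over \<open>m\<close> it reduces the conjugate Bailey pair at \<open>r + 1\<close> to the one at \<open>r\<close>.\<close>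

lemma tau_telescope:
  defines "G \<equiv> \<lambda>r m. - (1 + x ^ Suc r) * (1 - x ^ (m - r)) * tau m r"
  shows "tau m (Suc r) + x ^ Suc r * tau m r = G r (Suc m) - G r m"
proof (cases "r \<le> m")
  case True
  then obtain d where m: "m = r + d" using le_Suc_ex by blast
  \<comment> \<open>In terms of X = x^(m-r) and R = x^(r+1) the neighbours of \<open>tau m r\<close>
    are rational multiples of it, so the claim reduces to the polynomial identity
    \<open>eq\<close>.\<close>
  define X R b c where "X = x ^ d" and "R = x ^ Suc r"
    and "b = 1 - x ^ Suc (m + r + 1)" and "c = 1 - x ^ Suc d"
  have b0: "b \<noteq> 0" and c0: "c \<noteq> 0"
    unfolding b_def c_def by (rule one_minus_power_nz)+
  have b: "b = 1 - X * R * R" and XR: "x ^ Suc m = X * R"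
    by (simp_all add: b_def X_def R_def m add_ac flip: power_add power_Suc)
  have 1: "tau m (Suc r) = tau m r * (1 - X) / b"
  proof (cases d)
    case (Suc e)
    have "1 - X \<noteq> 0" using one_minus_power_nz[of e] by (simp add: X_def Suc)
    moreover have "qpoch (m - r) = qpoch (m - Suc r) * (1 - X)"
      using Suc by (simp add: m X_def qpoch_Suc)
    moreover have "qpoch (m + Suc r + 1) = qpoch (m + r + 1) * b"
      by (simp add: b_def qpoch_Suc)
    ultimately show ?thesis using b0 Suc m by (simp add: tau_def mult.assoc)
  qed (simp add: m tau_def X_def)
  have 2: "tau (Suc m) r = tau m r * (- (X * R)) * (1 - X * R) / (c * b)"
  proof -
    have "qpoch (Suc m - r) = qpoch (m - r) * c"
      by (simp add: m c_def qpoch_Suc)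
    moreover have "qpoch (Suc m + r + 1) = qpoch (m + r + 1) * b"
      by (simp add: b_def qpoch_Suc)
    moreover have "qpoch (Suc m) = qpoch m * (1 - X * R)"
      by (simp only: qpoch_Suc XR)
    moreover have "x ^ (Suc (Suc m) choose 2) = X * R * x ^ (Suc m choose 2)"
      by (simp only: Suc_choose_two[of "Suc m"] power_add XR)
    ultimately show ?thesis using True by (simp add: tau_def ac_simps)
  qed
  have "G r (Suc m) = - (1 + R) * c * tau (Suc m) r"
    using True by (simp add: G_def R_def c_def m)
  also have "\<dots> = (1 + R) * (X * R) * (1 - X * R) * tau m r / b"
    unfolding 2 using c0 b0 by (simp add: field_simps)
  finally have G1: "G r (Suc m) = \<dots>" .
  have G0: "G r m = - (1 + R) * (1 - X) * tau m r"
    by (simp add: G_def R_def X_def m)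
  have R: "x ^ Suc r = R" by (simp add: R_def)
  have "(1 - X) + R * b = (1 + R) * (X * R) * (1 - X * R) + (1 + R) * (1 - X) * b"
    unfolding b by (simp add: algebra_simps)
  note eq = this
  have "tau m r * (1 - X) / b + R * tau m r = ((1 - X) + R * b) * tau m r / b"
    using b0 by (simp add: field_simps)
  also have "\<dots> = (1 + R) * (X * R) * (1 - X * R) * tau m r / b - - (1 + R) * (1 - X) * tau m r"
    unfolding eq using b0 by (simp add: field_simps)
  finally show ?thesis unfolding G1 G0 R 1 .
next
  case False
  \<comment> \<open>The only term not killed by \<open>tau\<close> is \<open>G r (Suc m)\<close>
    with \<open>Suc m = r\<close>, and there the factor 1 - x^0 vanishes.\<close>
  then show ?thesis by (cases "Suc m = r") (auto simp: tau_def G_def)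
qed

text \<open>Summing the telescoping relation over m leaves 0, so the sum at r + 1 is -x^(r+1) times
  the sum at r. The case r = 0 telescopes by itself.\<close>

lemma tau_sums: "(\<lambda>m. tau m r) sums ((-1) ^ r * x ^ (Suc r choose 2))"
proof (induction r)
  case 0
  \<comment> \<open>At r = 0 the factor \<open>qpoch m\<close> cancels, leaving 1 /
    \<open>qpoch (Suc m)\<close>; splitting 1 = (1 - x^(m+1)) + x^(m+1) in the numerator exhibits
    the difference.\<close>
  define u where "u m = (-1) ^ m * x ^ (Suc m choose 2) / qpoch m" for m
  have "tau m 0 = u m - u (Suc m)" for m
  proof -
    have nz': "1 - x ^ Suc m \<noteq> 0" by (rule one_minus_power_nz)
    have c: "x ^ (Suc (Suc m) choose 2) = x ^ Suc m * x ^ (Suc m choose 2)"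
      by (simp only: Suc_choose_two[of "Suc m"] power_add)
    show ?thesis
      unfolding u_def c qpoch_Suc using nz'
      by (simp add: tau_def qpoch_Suc divide_simps del: power_Suc) (simp add: algebra_simps)
  qed
  moreover have "u \<longlonglongrightarrow> 0"
  proof (rule Lim_null_comparison)
    show "eventually (\<lambda>m. norm (u m) \<le> K ^ m * norm x ^ (Suc m choose 2)) sequentially"
    proof (intro always_eventually allI)
      fix m
      have "norm (1 / qpoch m) * norm x ^ (Suc m choose 2) \<le> K ^ m * norm x ^ (Suc m choose 2)"
        by (intro mult_right_mono norm_inverse_qpoch_le) auto
      then show "norm (u m) \<le> K ^ m * norm x ^ (Suc m choose 2)"
        by (simp add: u_def norm_mult norm_divide norm_power)
    qed
    show "(\<lambda>m. K ^ m * norm x ^ (Suc m choose 2)) \<longlonglongrightarrow> 0"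
      by (intro summable_LIMSEQ_zero summable_power_triangular) (use lt1 K_ge_1 in auto)
  qed
  ultimately show ?case
    using telescope_sums'[of u 0] by (simp add: u_def numeral_2_eq_2)
next
  case (Suc r)
  define G where "G m = - (1 + x ^ Suc r) * (1 - x ^ (m - r)) * tau m r" for m
  have "G \<longlonglongrightarrow> 0"
  proof (rule Lim_null_comparison)
    show "eventually (\<lambda>m. norm (G m) \<le> 4 * norm (tau m r)) sequentially"
    proof (intro always_eventually allI)
      fix m
      have p: "norm (x ^ k) \<le> 1" for k
        using lt1 by (simp add: norm_power power_le_one)
      have "norm (1 + x ^ Suc r) \<le> 2"
        using norm_triangle_ineq[of 1 "x ^ Suc r"] p[of "Suc r"] by simp
      moreover have "norm (1 - x ^ (m - r)) \<le> 2"
        using norm_triangle_ineq4[of 1 "x ^ (m - r)"] p[of "m - r"] by simp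
      ultimately have "norm (1 + x ^ Suc r) * norm (1 - x ^ (m - r)) * norm (tau m r) \<le> 2 * 2 * norm (tau m r)"
        by (intro mult_mono) auto
      moreover have "norm (G m) = norm (1 + x ^ Suc r) * norm (1 - x ^ (m - r)) * norm (tau m r)"
        unfolding G_def norm_mult norm_minus_cancel ..
      ultimately show "norm (G m) \<le> 4 * norm (tau m r)" by simp
    qed
    show "(\<lambda>m. 4 * norm (tau m r)) \<longlonglongrightarrow> 0"
      by (intro tendsto_mult_right_zero tendsto_norm_zero tau_tendsto_0)
  qed
  then have "(\<lambda>m. G (Suc m) - G m) sums (0 - G 0)"
    by (rule telescope_sums)
  then have "(\<lambda>m. tau m (Suc r) + x ^ Suc r * tau m r) sums (0 - G 0)"
    by (simp only: tau_telescope G_def)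
  \<comment> \<open>For r = 0 the factor 1 - x^0 vanishes, for r > 0 the factor
    \<open>tau 0 r\<close> does.\<close>
  moreover have "G 0 = 0" by (simp add: G_def tau_def)
  ultimately have "(\<lambda>m. tau m (Suc r) + x ^ Suc r * tau m r) sums 0" by simp
  from sums_diff[OF this sums_mult[OF Suc, of "x ^ Suc r"]]
  show ?case
    by (simp add: Suc_choose_two[of "Suc r"] power_add algebra_simps)
qed

text \<open>Fubini for an absolutely summable double family: rows give the first series, and
  \<open>tau_sums\<close> evaluates the columns of the second.\<close>

lemma sum_tau_swap:
  assumes y: "\<And>r. norm (y r) \<le> C * 2 ^ r"
  shows "\<exists>S. (\<lambda>m. \<Sum>r\<le>m. y r * tau m r) sums S \<and> (\<lambda>r. y r * ((-1) ^ r * x ^ (Suc r choose 2))) sums S"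
proof -
  define f where "f = (\<lambda>(m, r). y r * tau m r)"
  \<comment> \<open>The constant 8 collects three factors 2: from the bound for \<open>tau\<close>,
    from the growth of \<open>y\<close>, and from m + 1 <= 2^m for the number of terms in a
    row.\<close>
  define g where "g m = C * K * ((8 * K\<^sup>2) ^ m * norm x ^ (Suc m choose 2))" for m
  have "0 \<le> C" using order_trans[OF norm_ge_zero y[of 0]] by simp
  \<comment> \<open>Used with the norm for absolute summability and with the identity for the value
    of a row.\<close>
  have slice: "((\<lambda>r. h (f (m, r))) has_sum (\<Sum>r\<le>m. h (f (m, r)))) UNIV" if "h 0 = 0"
    for m and h :: "complex \<Rightarrow> 'b::{comm_monoid_add, topological_space}"
    by (rule has_sum_finite_neutralI[of "{..m}"]) (auto simp: f_def tau_def that)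
  have bound: "(\<Sum>r\<le>m. norm (f (m, r))) \<le> g m" for m
  proof -
    have "norm (f (m, r)) \<le> C * 2 ^ m * (K * ((2 * K\<^sup>2) ^ m * norm x ^ (Suc m choose 2)))" if "r \<le> m" for r
    proof -
      have "C * 2 ^ r \<le> C * 2 ^ m" using that \<open>0 \<le> C\<close> by (intro mult_left_mono power_increasing) auto
      then have "norm (y r) \<le> C * 2 ^ m" using y[of r] by linarith
      then show ?thesis
        unfolding f_def by (simp only: prod.case norm_mult) (intro mult_mono norm_tau_le, auto simp: \<open>0 \<le> C\<close>)
    qed
    then have "(\<Sum>r\<le>m. norm (f (m, r))) \<le> (\<Sum>r\<le>m. C * 2 ^ m * (K * ((2 * K\<^sup>2) ^ m * norm x ^ (Suc m choose 2))))"
      by (intro sum_mono) auto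
    also have "\<dots> = real (Suc m) * (C * 2 ^ m * (K * ((2 * K\<^sup>2) ^ m * norm x ^ (Suc m choose 2))))"
      by simp
    also have "\<dots> \<le> 2 ^ m * (C * 2 ^ m * (K * ((2 * K\<^sup>2) ^ m * norm x ^ (Suc m choose 2))))"
    proof (intro mult_right_mono)
      show "real (Suc m) \<le> 2 ^ m"
        using of_nat_mono[OF Suc_leI[OF less_exp[of m]], where 'a=real] by simp
    qed (use \<open>0 \<le> C\<close> K_ge_1 in auto)
    also have "\<dots> = g m"
    proof -
      have "8 * K\<^sup>2 = 2 * (2 * (2 * K\<^sup>2))" by simp
      then have "(8 * K\<^sup>2) ^ m = 2 ^ m * (2 ^ m * (2 * K\<^sup>2) ^ m)"
        by (simp only: power_mult_distrib)
      then show ?thesis by (simp only: g_def ac_simps)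
    qed
    finally show ?thesis .
  qed
  have "summable g"
    unfolding g_def by (intro summable_mult summable_power_triangular) (use lt1 in auto)
  then have "(\<lambda>m. \<Sum>r\<le>m. norm (f (m, r))) summable_on UNIV"
    by (intro summable_nonneg_imp_summable_on summable_comparison_test[OF _ \<open>summable g\<close>])
      (auto intro!: sum_nonneg exI[of _ 0] simp: bound sum_nonneg)
  then have "(\<lambda>z. norm (f z)) summable_on (UNIV \<times> UNIV)"
    by (intro summable_on_SigmaI[OF slice[of norm]]) auto
  then have sum_f: "f summable_on (UNIV \<times> UNIV)"
    by (rule Infinite_Sum.abs_summable_summable)
  then obtain S where S: "(f has_sum S) (UNIV \<times> UNIV)"
    by (auto simp: summable_on_def)
  have "(\<lambda>m. \<Sum>r\<le>m. y r * tau m r) sums S"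
    using has_sum_SigmaD[OF S slice[of "\<lambda>z. z"]] by (intro has_sum_imp_sums) (simp add: f_def)
  moreover have "(\<lambda>r. y r * ((-1) ^ r * x ^ (Suc r choose 2))) sums S"
  proof -
    have S': "((\<lambda>(r, m). f (m, r)) has_sum S) (UNIV \<times> UNIV)"
      using S by (subst has_sum_swap) auto
    have "((\<lambda>m. f (m, r)) has_sum y r * ((-1) ^ r * x ^ (Suc r choose 2))) UNIV" for r
    proof -
      \<comment> \<open>\<open>tau_sums\<close> speaks of ordered series; unconditional summability
        of each column comes from the double family, and the limits agree by uniqueness.\<close>
      have "(\<lambda>m. f (m, r)) summable_on UNIV"
        using summable_on_SigmaD1[of "\<lambda>r m. f (m, r)" UNIV "\<lambda>_. UNIV" r] S'
        by (auto simp: summable_on_def)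
      then obtain T where T: "((\<lambda>m. f (m, r)) has_sum T) UNIV"
        by (auto simp: summable_on_def)
      moreover have "(\<lambda>m. f (m, r)) sums (y r * ((-1) ^ r * x ^ (Suc r choose 2)))"
        unfolding f_def prod.case by (intro sums_mult tau_sums)
      ultimately show ?thesis
        using has_sum_imp_sums[OF T] sums_unique2 by blast
    qed
    then show ?thesis
      using has_sum_SigmaD[OF S'] by (intro has_sum_imp_sums) simp
  qed
  ultimately show ?thesis by blast
qed

section \<open>Growth of \<open>E\<close> and the Bailey transform\<close>

lemma norm_w_le: "norm (w N) \<le> 1"
proof -
  have "0 \<le> N * (N - 1)"
    by (cases "N \<le> 0") (auto simp: zero_le_mult_iff)
  then have "norm (x powi (N * (N - 1) div 2)) \<le> 1"
    using lt1 by (simp add: power_int_def norm_power power_le_one)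
  then show ?thesis by (simp add: w_def norm_mult norm_power_int)
qed

lemma norm_E_le: "norm (E N) \<le> \<bar>real_of_int N\<bar> + 1"
proof -
  have "norm (w a * w b) \<le> 1" for a b
    using mult_mono[OF norm_w_le[of a] norm_w_le[of b]] by (simp add: norm_mult)
  then have *: "norm (\<Sum>a\<in>A. w a * w (N - a)) \<le> real (card A)" for A
    by (rule sum_norm_bound[of A _ 1, simplified])
  show ?thesis
    using *[of "{0..N}"] *[of "{N+1..-1}"] by (auto simp: E_def)
qed

text \<open>For negative N the power of \<open>x\<close> alone grows exponentially; the recurrence
  shows that the product still grows at most linearly.\<close>

lemma norm_power_E_le: "norm (x powi N * E N) \<le> \<bar>real_of_int N\<bar> + 5"
proof -
  have "x powi N * E N = E (N + 2) - 2 * w (N + 2)"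
    by (simp add: E_add_two)
  then have "norm (x powi N * E N) \<le> norm (E (N + 2)) + norm (2 * w (N + 2))"
    using norm_triangle_ineq4 by metis
  also have "\<dots> \<le> (\<bar>real_of_int (N + 2)\<bar> + 1) + 2"
    using norm_w_le[of "N + 2"] by (intro add_mono norm_E_le) (simp add: norm_mult)
  finally show ?thesis by simp
qed

text \<open>\<open>y\<close> combines the two Bailey pairs, the second weighted by \<open>q\<close>,
  which produces the factor 1 + q x^m. The finite inner sums are evaluated by
  \<open>conv_fold\<close> and the middle-entry formulas, the exchanged ones by
  \<open>tau_sums\<close>.\<close>

lemma sums_Bailey_transform:
  assumes "norm q \<le> 1"
  defines "y \<equiv> \<lambda>r. E (int r) + E (-1 - int r) +
    q * (x powi int r * E (int r) + x powi (-1 - int r) * E (-1 - int r))"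
  shows "\<exists>S. (\<lambda>m. x ^ m\<^sup>2 * (1 + q * x ^ m) * (qpoch m)\<^sup>2 / qpoch (2 * m + 1)) sums S \<and>
    (\<lambda>r. (-1) ^ r * x ^ (Suc r choose 2) * y r) sums S"
proof -
  have "norm (y r) \<le> 16 * 2 ^ r" for r
  proof -
    have "norm (y r) \<le> norm (E (int r)) + norm (E (-1 - int r)) +
      norm q * (norm (x powi int r * E (int r)) + norm (x powi (-1 - int r) * E (-1 - int r)))"
      unfolding y_def by (intro order.trans[OF norm_triangle_ineq] add_mono order.refl)
        (auto simp: norm_triangle_ineq norm_mult intro!: mult_left_mono order.trans[OF norm_triangle_ineq])
    also have "\<dots> \<le> (real r + 1) + (real r + 2) + 1 * ((real r + 5) + (real r + 6))"
      using norm_E_le[of "int r"] norm_E_le[of "-1 - int r"] norm_power_E_le[of "int r"]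
        norm_power_E_le[of "-1 - int r"] assms(1)
      by (intro add_mono mult_mono) auto
    also have "\<dots> \<le> 16 * real (Suc r)" by simp
    also have "\<dots> \<le> 16 * 2 ^ r"
      using of_nat_mono[OF Suc_leI[OF less_exp[of r]], where 'a=real] by simp
    finally show ?thesis .
  qed
  then obtain S where S: "(\<lambda>m. \<Sum>r\<le>m. y r * tau m r) sums S"
      "(\<lambda>r. y r * ((-1) ^ r * x ^ (Suc r choose 2))) sums S"
    using sum_tau_swap by blast
  have "(\<Sum>r\<le>m. y r * tau m r) = x ^ m\<^sup>2 * (1 + q * x ^ m) * (qpoch m)\<^sup>2 / qpoch (2 * m + 1)" for m
  proof -
    let ?c = "(-1) ^ m * x ^ (Suc m choose 2) * qpoch m / qpoch (2 * m + 1)"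
    have "y r * tau m r = ?c * (y r * qbin (2 * m + 1) (m - r))" if "r \<le> m" for r
    proof -
      have "2 * m + 1 - (m - r) = m + r + 1" using that by simp
      then show ?thesis using that by (simp add: tau_def qbin_def)
    qed
    then have "(\<Sum>r\<le>m. y r * tau m r) = ?c * (\<Sum>r\<le>m. y r * qbin (2 * m + 1) (m - r))"
      by (simp add: sum_distrib_left)
    also have "(\<Sum>r\<le>m. y r * qbin (2 * m + 1) (m - r)) =
        conv E (2 * m + 1) (int m) + q * conv (\<lambda>N. x powi N * E N) (2 * m + 1) (int m)"
      unfolding conv_fold y_def by (simp add: sum_distrib_left sum.distrib algebra_simps)
    also have "\<dots> = (1 + q * x ^ m) * ((-1) ^ m * x ^ (m choose 2) * qpoch m)"
      unfolding conv_power_E_middle conv_E_middle(1) by (simp add: algebra_simps)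
    also have "?c * \<dots> = ((-1) ^ m * (-1) ^ m) * (x ^ (Suc m choose 2) * x ^ (m choose 2)) *
        (1 + q * x ^ m) * (qpoch m)\<^sup>2 / qpoch (2 * m + 1)"
      by (simp add: power2_eq_square)
    also have "(-1) ^ m * (-1) ^ m = (1::complex)"
      by (simp flip: power_mult_distrib)
    also have "x ^ (Suc m choose 2) * x ^ (m choose 2) = x ^ m\<^sup>2"
      by (simp add: choose_two_add flip: power_add)
    finally show ?thesis by simp
  qed
  then show ?thesis using S by (auto simp: ac_simps)
qed

end

section \<open>Comparison with the two series\<close>

text \<open>Adding or subtracting the alternating sum isolates the j of the same or the opposite
  parity as n, parametrized by j = 2a - n and j = 2a - n - 1.\<close>

lemma sum_even_split:
  fixes f :: "int \<Rightarrow> complex"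
  shows "(\<Sum>j\<in>{- int n..int n}. f j) + (-1) ^ n * (\<Sum>j\<in>{- int n..int n}. (-1) powi j * f j) =
    2 * (\<Sum>a\<in>{0..int n}. f (2 * a - int n))" (is ?even)
  and "(\<Sum>j\<in>{- int n..int n}. f j) - (-1) ^ n * (\<Sum>j\<in>{- int n..int n}. (-1) powi j * f j) =
    2 * (\<Sum>a\<in>{1..int n}. f (2 * a - int n - 1))" (is ?odd)
proof -
  let ?J = "{- int n..int n}"
  have sgn: "(-1) ^ n * ((-1) powi j * f j) = (if even (int n + j) then f j else - f j)" for j
    by (auto simp: power_int_minus_left)
  have "(\<Sum>j\<in>?J. f j) + (-1) ^ n * (\<Sum>j\<in>?J. (-1) powi j * f j) = (\<Sum>j\<in>?J. if even (int n + j) then 2 * f j else 0)"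
    unfolding sum_distrib_left sgn sum.distrib[symmetric] by (intro sum.cong) auto
  also have "\<dots> = (\<Sum>j\<in>{j \<in> ?J. even (int n + j)}. 2 * f j)"
    by (simp only: sum.inter_filter finite_atLeastAtMost_int)
  also have "\<dots> = (\<Sum>a\<in>{0..int n}. 2 * f (2 * a - int n))"
    by (rule sum.reindex_bij_witness[of _ "\<lambda>a. 2 * a - int n" "\<lambda>j. (int n + j) div 2"]) auto
  finally show ?even by (simp add: sum_distrib_left)
  have "(\<Sum>j\<in>?J. f j) - (-1) ^ n * (\<Sum>j\<in>?J. (-1) powi j * f j) = (\<Sum>j\<in>?J. if odd (int n + j) then 2 * f j else 0)"
    unfolding sum_distrib_left sgn sum_subtractf[symmetric] by (intro sum.cong) auto
  also have "\<dots> = (\<Sum>j\<in>{j \<in> ?J. odd (int n + j)}. 2 * f j)"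
    by (simp only: sum.inter_filter finite_atLeastAtMost_int)
  also have "\<dots> = (\<Sum>a\<in>{1..int n}. 2 * f (2 * a - int n - 1))"
  proof (rule sum.reindex_bij_witness[of _ "\<lambda>a. 2 * a - int n - 1" "\<lambda>j. (int n + j + 1) div 2"])
    fix j assume j: "j \<in> {j \<in> ?J. odd (int n + j)}"
    then have "odd (int n + j)" by simp
    then have "2 * ((int n + j + 1) div 2) = int n + j + 1" by presburger
    then show eq: "2 * ((int n + j + 1) div 2) - int n - 1 = j"
      by simp
    then show "2 * f (2 * ((int n + j + 1) div 2) - int n - 1) = 2 * f j"
      by (simp only:)
    have "j \<noteq> int n" using j by auto
    then show "(int n + j + 1) div 2 \<in> {1..int n}"
      using j eq unfolding atLeastAtMost_iff mem_Collect_eq by linarith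
  qed auto
  finally show ?odd by (simp add: sum_distrib_left)
qed

text \<open>The sign of the half-integer power differs between the two series, so this power ends up
  attached to the opposite parity class only.\<close>

lemma rhs_terms_average:
  assumes "q = s\<^sup>2"
  shows "(rhs_term1 q s n + rhs_term2 q s n) / 2 = s ^ (3 * n\<^sup>2) * (1 + q ^ (2 * n + 1)) *
    ((\<Sum>a\<in>{0..int n}. s powi (2 * a - int n)\<^sup>2) + s ^ (2 * n + 1) * (\<Sum>a\<in>{1..int n}. s powi (2 * a - int n - 1)\<^sup>2))"
proof -
  define T1 T2 where "T1 = (\<Sum>j\<in>{- int n..int n}. s powi j\<^sup>2)"
    and "T2 = (\<Sum>j\<in>{- int n..int n}. (-1) powi j * s powi j\<^sup>2)"
  have P: "(\<Sum>a\<in>{0..int n}. s powi (2 * a - int n)\<^sup>2) = (T1 + (-1) ^ n * T2) / 2"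
    and R: "(\<Sum>a\<in>{1..int n}. s powi (2 * a - int n - 1)\<^sup>2) = (T1 - (-1) ^ n * T2) / 2"
    unfolding T1_def T2_def using sum_even_split[of "\<lambda>j. s powi j\<^sup>2" n] by simp_all
  show ?thesis
    unfolding P R rhs_term1_def rhs_term2_def T1_def[symmetric] T2_def[symmetric]
    by (simp add: field_simps)
qed

text \<open>Since n^2 is the sum of two consecutive triangular numbers, s^(3n^2) is dominated by a
  triangular power; the inner sum has 2n + 1 <= 3^n terms of norm at most 1.\<close>

lemma
  assumes "norm s < 1" "norm q \<le> 1"
  shows summable_rhs_term1: "summable (rhs_term1 q s)"
    and summable_rhs_term2: "summable (rhs_term2 q s)"
proof -
  have p: "norm (z ^ k) \<le> 1" if "norm z \<le> 1" for z :: complex and k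
    using that by (simp add: norm_power power_le_one)
  have ps: "norm (s ^ k) \<le> 1" and pq: "norm (q ^ k) \<le> 1" for k
    using assms by (auto intro!: p)
  have psi: "norm (s powi j\<^sup>2) \<le> 1" for j
    using assms by (simp add: power_int_def norm_power power_le_one)
  have bound: "norm (s ^ (3 * n\<^sup>2) * (1 + q ^ (2 * n + 1)) * c * (\<Sum>j\<in>{- int n..int n}. f j)) \<le>
      4 * (3 ^ n * norm s ^ (Suc n choose 2))"
    if c: "norm c \<le> 2" and f: "\<And>j. norm (f j) \<le> 1" for n c f
  proof -
    have 1: "norm (s ^ (3 * n\<^sup>2)) \<le> norm s ^ (Suc n choose 2)"
      unfolding norm_power using assms choose_two_add[of n] by (intro power_decreasing) auto
    have 2: "norm (1 + q ^ (2 * n + 1)) \<le> 2"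
      using norm_triangle_ineq[of 1 "q ^ (2 * n + 1)"] pq[of "2 * n + 1"] by simp
    have "norm (\<Sum>j\<in>{- int n..int n}. f j) \<le> real (2 * n + 1)"
      using sum_norm_bound[of "{- int n..int n}" f 1] f by (simp add: nat_add_distrib)
    also have "real (2 * n + 1) \<le> 3 ^ n"
      using Bernoulli_inequality[of "2::real" n] by simp
    finally have "norm (\<Sum>j\<in>{- int n..int n}. f j) \<le> 3 ^ n" .
    then have "norm (s ^ (3 * n\<^sup>2)) * norm (1 + q ^ (2 * n + 1)) * norm c * norm (\<Sum>j\<in>{- int n..int n}. f j) \<le>
        norm s ^ (Suc n choose 2) * 2 * 2 * 3 ^ n"
      using 1 2 c by (intro mult_mono) auto
    then show ?thesis by (simp only: norm_mult) (simp add: mult_ac)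
  qed
  have sm: "summable (\<lambda>n. 4 * (3 ^ n * norm s ^ (Suc n choose 2)))"
    using assms by (intro summable_mult summable_power_triangular) auto
  have c: "norm (1 + s ^ k) \<le> 2" "norm (1 - s ^ k) \<le> 2" for k
    using norm_triangle_ineq[of 1 "s ^ k"] norm_triangle_ineq4[of 1 "s ^ k"] ps[of k] by simp_all
  have "norm (rhs_term1 q s n) \<le> 4 * (3 ^ n * norm s ^ (Suc n choose 2))"
    and "norm (rhs_term2 q s n) \<le> 4 * (3 ^ n * norm s ^ (Suc n choose 2))" for n
  proof -
    show "norm (rhs_term1 q s n) \<le> 4 * (3 ^ n * norm s ^ (Suc n choose 2))"
      unfolding rhs_term1_def by (intro bound psi c)
    have "norm (rhs_term2 q s n) = norm (s ^ (3 * n\<^sup>2) * (1 + q ^ (2 * n + 1)) * (1 - s ^ (2 * n + 1)) *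
        (\<Sum>j\<in>{- int n..int n}. (-1) powi j * s powi j\<^sup>2))"
      by (simp add: rhs_term2_def norm_mult norm_power)
    also have "\<dots> \<le> 4 * (3 ^ n * norm s ^ (Suc n choose 2))"
      by (intro bound c) (use psi in \<open>simp add: norm_mult norm_power_int\<close>)
    finally show "norm (rhs_term2 q s n) \<le> 4 * (3 ^ n * norm s ^ (Suc n choose 2))" .
  qed
  then show "summable (rhs_term1 q s)" "summable (rhs_term2 q s)"
    by (blast intro: summable_comparison_test'[OF sm])+
qed

context punctured_disc
begin

text \<open>With b the partner of a, the exponent of \<open>s\<close> is 2n(n+1) + 2a(a-1) +
  2b(b-1). It equals 3n^2 + (a-b)^2 if a + b = n, and 3(n+1)^2 + (a-b)^2 if a + b = -1 - n.\<close>

lemma E_weighted: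
  assumes x: "x = s ^ 4"
  shows "(-1) ^ n * x ^ (Suc n choose 2) * E (int n) = s ^ (3 * n\<^sup>2) * (\<Sum>a\<in>{0..int n}. s powi (2 * a - int n)\<^sup>2)"
      (is ?pos)
    and "(-1) ^ n * x ^ (Suc n choose 2) * E (-1 - int n) =
      s ^ (3 * n\<^sup>2 + 6 * n + 3) * (\<Sum>a\<in>{1..int n}. s powi (2 * a - int n - 1)\<^sup>2)" (is ?neg)
proof -
  have s: "s \<noteq> 0" using nz x by auto
  have ws: "w a = (-1) powi a * s powi (2 * (a * (a - 1)))" for a
  proof -
    have "even (a * (a - 1))" by simp
    then have "4 * (a * (a - 1) div 2) = 2 * (a * (a - 1))" by (metis dvd_mult_div_cancel mult.assoc mult_2 numeral_Bit0 distrib_right)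
    moreover have "x powi k = s powi (4 * k)" for k
      unfolding x by (simp add: power_int_mult)
    ultimately show ?thesis by (simp only: w_def)
  qed
  have c: "x ^ (Suc n choose 2) = s powi (2 * (int n * (int n + 1)))"
  proof -
    have "4 * (Suc n choose 2) = 2 * (n * (n + 1))"
      by (induction n) (simp_all add: Suc_choose_two binomial_eq_0)
    then have "x ^ (Suc n choose 2) = s ^ (2 * (n * (n + 1)))"
      unfolding x by (metis power_mult)
    also have "\<dots> = s powi int (2 * (n * (n + 1)))" by (simp only: power_int_of_nat)
    finally show ?thesis by (simp add: algebra_simps)
  qed
  have key: "x ^ (Suc n choose 2) * (w a * w b) = (-1) powi (a + b) * (s powi k * s powi l)"
    if "2 * (int n * (int n + 1)) + 2 * (a * (a - 1)) + 2 * (b * (b - 1)) = k + l" for a b k l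
  proof -
    have pa: "s powi i * s powi j = s powi (i + j)" for i j
      using s by (simp add: power_int_add)
    have "x ^ (Suc n choose 2) * (w a * w b) = (-1) powi a * (-1) powi b *
        (s powi (2 * (int n * (int n + 1))) * s powi (2 * (a * (a - 1))) * s powi (2 * (b * (b - 1))))"
      by (simp only: ws c mult_ac)
    then show ?thesis unfolding pa that by (simp add: power_int_add)
  qed
  have "(-1) ^ n * x ^ (Suc n choose 2) * E (int n) =
      (\<Sum>a\<in>{0..int n}. (-1) ^ n * (x ^ (Suc n choose 2) * (w a * w (int n - a))))"
    by (simp add: E_def sum_distrib_left mult.assoc)
  also have "\<dots> = (\<Sum>a\<in>{0..int n}. s ^ (3 * n\<^sup>2) * s powi (2 * a - int n)\<^sup>2)"
  proof (rule sum.cong)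
    fix a
    have "x ^ (Suc n choose 2) * (w a * w (int n - a)) =
        (-1) powi (a + (int n - a)) * (s powi (3 * (int n)\<^sup>2) * s powi (2 * a - int n)\<^sup>2)"
      by (rule key) (simp add: power2_eq_square algebra_simps)
    moreover have "s powi (3 * (int n)\<^sup>2) = s ^ (3 * n\<^sup>2)"
      using power_int_of_nat[of s "3 * n\<^sup>2"] by simp
    moreover have "(-1) ^ n * (-1) powi (a + (int n - a)) = (1::complex)"
      by (simp flip: power_mult_distrib)
    ultimately show "(-1) ^ n * (x ^ (Suc n choose 2) * (w a * w (int n - a))) = s ^ (3 * n\<^sup>2) * s powi (2 * a - int n)\<^sup>2"
      by (simp only: mult.assoc[symmetric]) simp
  qed simp
  finally show ?pos by (simp add: sum_distrib_left)
  have "(-1) ^ n * x ^ (Suc n choose 2) * E (-1 - int n) =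
      (\<Sum>a\<in>{- int n..-1}. - ((-1) ^ n * (x ^ (Suc n choose 2) * (w a * w (-1 - int n - a)))))"
    by (simp add: E_def sum_distrib_left mult.assoc sum_negf)
  also have "\<dots> = (\<Sum>a\<in>{- int n..-1}. s ^ (3 * n\<^sup>2 + 6 * n + 3) * s powi (2 * a + int n + 1)\<^sup>2)"
  proof (rule sum.cong)
    fix a
    have "x ^ (Suc n choose 2) * (w a * w (-1 - int n - a)) =
        (-1) powi (a + (-1 - int n - a)) * (s powi (3 * (int n)\<^sup>2 + 6 * int n + 3) * s powi (2 * a + int n + 1)\<^sup>2)"
      by (rule key) (simp add: power2_eq_square algebra_simps)
    moreover have "s powi (3 * (int n)\<^sup>2 + 6 * int n + 3) = s ^ (3 * n\<^sup>2 + 6 * n + 3)"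
      using power_int_of_nat[of s "3 * n\<^sup>2 + 6 * n + 3"] by (simp only: of_nat_add of_nat_mult of_nat_power of_nat_numeral)
    \<comment> \<open>This sign cancels the minus with which \<open>E\<close> counts negative
      pairs.\<close>
    moreover have "(-1) ^ n * (-1) powi (a + (-1 - int n - a)) = (-1::complex)"
      by (simp add: power_int_diff flip: power_mult_distrib)
    ultimately show "- ((-1) ^ n * (x ^ (Suc n choose 2) * (w a * w (-1 - int n - a)))) =
        s ^ (3 * n\<^sup>2 + 6 * n + 3) * s powi (2 * a + int n + 1)\<^sup>2"
      by (simp only: mult.assoc[symmetric]) simp
  qed simp
  also have "\<dots> = (\<Sum>a\<in>{1..int n}. s ^ (3 * n\<^sup>2 + 6 * n + 3) * s powi (2 * a - int n - 1)\<^sup>2)"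
    by (rule sum.reindex_bij_witness[of _ uminus uminus])
      (auto simp: power2_eq_square algebra_simps)
  finally show ?neg by (simp add: sum_distrib_left)
qed

text \<open>Put u = s^(2n+1). The two brackets are 1 + u^2 and 1 + u^(-2), and s^(3(n+1)^2) =
  s^(3n^2) u^3, so 1 + u^2 factors out of both contributions.\<close>

lemma swapped_term_eq:
  assumes q: "q = s\<^sup>2" and x: "x = s ^ 4"
  shows "(-1) ^ n * x ^ (Suc n choose 2) * (E (int n) + E (-1 - int n) +
      q * (x powi int n * E (int n) + x powi (-1 - int n) * E (-1 - int n))) =
    (rhs_term1 q s n + rhs_term2 q s n) / 2"
proof -
  have s: "s \<noteq> 0" using nz x by auto
  define P R where "P = (\<Sum>a\<in>{0..int n}. s powi (2 * a - int n)\<^sup>2)"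
    and "R = (\<Sum>a\<in>{1..int n}. s powi (2 * a - int n - 1)\<^sup>2)"
  define c where "c = (-1) ^ n * x ^ (Suc n choose 2)"
  define u where "u = s ^ (2 * n + 1)"
  have E1: "c * E (int n) = s ^ (3 * n\<^sup>2) * P" and E2: "c * E (-1 - int n) = s ^ (3 * n\<^sup>2 + 6 * n + 3) * R"
    unfolding c_def P_def R_def by (rule E_weighted[OF x])+
  have q1: "q * x powi int n = u\<^sup>2"
    unfolding q x u_def power_int_of_nat power_mult[symmetric] power_add[symmetric]
    by (rule arg_cong[of _ _ "\<lambda>k. s ^ k"]) simp
  have q2: "q * x powi (-1 - int n) * u\<^sup>2 = 1"
  proof -
    have "q * x powi (-1 - int n) * u\<^sup>2 = (q * q) * (x powi (-1 - int n) * x powi int n)"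
      unfolding q1[symmetric] by simp
    also have "q * q = x" by (simp add: q x power2_eq_square power4_eq_xxxx)
    also have "x powi (-1 - int n) * x powi int n = x powi (-1)"
      using nz power_int_add[of x "-1 - int n" "int n"] by simp
    finally show ?thesis using nz by (simp add: power_int_minus)
  qed
  have u3: "s ^ (3 * n\<^sup>2 + 6 * n + 3) = s ^ (3 * n\<^sup>2) * (u\<^sup>2 * u)"
    unfolding u_def power_mult[symmetric] power_add[symmetric]
    by (rule arg_cong[of _ _ "\<lambda>k. s ^ k"]) (simp add: algebra_simps)
  have "c * (E (int n) + E (-1 - int n) + q * (x powi int n * E (int n) + x powi (-1 - int n) * E (-1 - int n))) =
      c * E (int n) * (1 + q * x powi int n) + c * E (-1 - int n) * (1 + q * x powi (-1 - int n))"
    by (simp add: algebra_simps)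
  also have "\<dots> = s ^ (3 * n\<^sup>2) * P * (1 + u\<^sup>2) + s ^ (3 * n\<^sup>2) * u * R * (u\<^sup>2 + q * x powi (-1 - int n) * u\<^sup>2)"
    unfolding E1 E2 q1 u3 by (simp add: algebra_simps)
  also have "\<dots> = s ^ (3 * n\<^sup>2) * (1 + u\<^sup>2) * (P + u * R)"
    unfolding q2 by (simp add: algebra_simps)
  also have "u\<^sup>2 = q ^ (2 * n + 1)" by (simp only: q u_def power_mult[symmetric] mult.commute)
  finally show ?thesis
    unfolding rhs_terms_average[OF q] P_def R_def u_def c_def .
qed

end

section \<open>The generating function of the pairs\<close>

text \<open>Unconditional summability of complex families is absolute, which makes the product
  family summable.\<close>

lemma has_sum_Times_mult:
  fixes f :: "'a \<Rightarrow> complex" and g :: "'b \<Rightarrow> complex"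
  assumes f: "(f has_sum a) A" and g: "(g has_sum b) B"
  shows "((\<lambda>(u, v). f u * g v) has_sum a * b) (A \<times> B)"
proof (rule has_sum_SigmaI)
  show "((\<lambda>v. case (u, v) of (u, v) \<Rightarrow> f u * g v) has_sum f u * b) B" for u
    using has_sum_cmult_right[OF g] by simp
  show "((\<lambda>u. f u * b) has_sum a * b) A"
    by (rule has_sum_cmult_left[OF f])
  have nf: "(\<lambda>u. norm (f u)) summable_on A" and ng: "(\<lambda>v. norm (g v)) summable_on B"
    using has_sum_imp_summable[OF f] has_sum_imp_summable[OF g] by (simp_all only: summable_on_iff_abs_summable_on_complex)
  have "(\<lambda>z. norm (case z of (u, v) \<Rightarrow> f u * g v)) summable_on A \<times> B"
  proof (rule summable_on_SigmaI)
    show "((\<lambda>v. norm (case (u, v) of (u, v) \<Rightarrow> f u * g v)) has_sum norm (f u) * (\<Sum>\<^sub>\<infinity>v\<in>B. norm (g v))) B" for u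
      using has_sum_cmult_right[OF has_sum_infsum[OF ng]] by (simp add: norm_mult)
    show "(\<lambda>u. norm (f u) * (\<Sum>\<^sub>\<infinity>v\<in>B. norm (g v))) summable_on A"
      by (rule summable_on_cmult_left[OF nf])
  qed auto
  then show "(\<lambda>(u, v). f u * g v) summable_on A \<times> B"
    by (rule Infinite_Sum.abs_summable_summable)
qed

lemma has_sum_geometric_complex:
  fixes z :: complex
  assumes "norm z < 1"
  shows "((\<lambda>n. z ^ n) has_sum 1 / (1 - z)) UNIV"
  using assms by (intro norm_summable_imp_has_sum geometric_sums) (simp_all add: norm_power summable_geometric)

section \<open>Splitting off all copies of one part size\<close>

lemma add_filter_replicate_mset:
  "filter_mset (\<lambda>k. k \<noteq> p) M + replicate_mset (count M p) p = M"
  by (rule multiset_eqI) simp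

lemma sum_mset_replicate_nat: "sum_mset (replicate_mset k p) = k * (p::nat)"
  by (induction k) auto

lemma count_eq_0_filter: "p \<notin># M \<Longrightarrow> filter_mset (\<lambda>k. k \<noteq> p) M = M"
  by (rule multiset_eqI) (auto simp: not_in_iff)

definition even_overpartitions :: "nat \<Rightarrow> (nat multiset \<times> nat set) set" where
  "even_overpartitions m = {\<mu>. is_overpartition \<mu> \<and> (\<forall>k \<in># fst \<mu>. even k \<and> k \<le> 2 * m)}"

text \<open>Evenness is demanded of every count, since absent parts have count 0; the condition then
  passes easily through filtering.\<close>

definition odd_partitions_below :: "nat \<Rightarrow> nat multiset set" where
  "odd_partitions_below m = {L. set_mset L = {k. odd k \<and> k < 2 * m + 1} \<and> (\<forall>k. even (count L k))}"

text \<open>The free multiplicity of 2m + 1 is expressed by deleting that part, the form that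
  \<open>has_sum_add_part\<close> takes.\<close>

definition odd_partitions :: "nat \<Rightarrow> nat multiset set" where
  "odd_partitions m = {L. filter_mset (\<lambda>k. k \<noteq> 2 * m + 1) L \<in> odd_partitions_below m}"

lemma odd_partitions_iff:
  "L \<in> odd_partitions m \<longleftrightarrow> (\<forall>k \<in># L. odd k \<and> k \<le> 2 * m + 1) \<and>
     (\<forall>k. odd k \<and> k < 2 * m + 1 \<longrightarrow> k \<in># L \<and> even (count L k))" (is "?l \<longleftrightarrow> ?r")
proof
  assume l: ?l
  then have S: "k \<in># L \<and> k \<noteq> 2 * m + 1 \<longleftrightarrow> odd k \<and> k < 2 * m + 1"
    and ev: "k \<noteq> 2 * m + 1 \<Longrightarrow> even (count L k)" for k
    by (auto simp: odd_partitions_def odd_partitions_below_def set_eq_iff split: if_splits)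
  have "odd k \<and> k \<le> 2 * m + 1" if "k \<in># L" for k
    using S[of k] that by (cases "k = 2 * m + 1") auto
  moreover have "k \<in># L \<and> even (count L k)" if "odd k \<and> k < 2 * m + 1" for k
    using S[of k] ev[of k] that by blast
  ultimately show ?r by blast
next
  assume r: ?r
  have "even (count L k)" if "k \<noteq> 2 * m + 1" for k
    using r that by (cases "k \<in># L") (auto simp: not_in_iff le_less)
  moreover have "k \<in># L \<and> k \<noteq> 2 * m + 1 \<longleftrightarrow> odd k \<and> k < 2 * m + 1" for k
    using r by (metis le_less less_irrefl)
  ultimately show ?l
    by (auto simp: odd_partitions_def odd_partitions_below_def set_eq_iff)
qed

lemma Q_pairs_eq:
  "Q_pairs m j n = {p \<in> even_overpartitions m \<times> odd_partitions m.
     size (fst (fst p)) = j \<and> sum_mset (fst (fst p)) + sum_mset (snd p) = n}"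
proof -
  have "is_partition L" if "L \<in> odd_partitions m" for L
    using that by (auto simp: odd_partitions_iff is_partition_def)
  then show ?thesis
    by (auto simp: Q_pairs_def even_overpartitions_def odd_partitions_iff)
qed

lemma even_overpartitions_0: "even_overpartitions 0 = {({#}, {})}"
proof -
  have "P = {#} \<and> T = {}" if "(P, T) \<in> even_overpartitions 0" for P T
  proof -
    have "x \<notin># P" for x
      using that by (auto simp: even_overpartitions_def is_overpartition_def is_partition_def)
    then have "P = {#}" by (meson multiset_nonemptyE)
    then show ?thesis using that by (simp add: even_overpartitions_def is_overpartition_def)
  qed
  then show ?thesis
    by (auto simp: even_overpartitions_def is_overpartition_def is_partition_def)
qed

text \<open>Induction on the largest admissible part. The variable t marks the number of parts; both
  t = -1 and t = 1 are needed later.\<close>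

lemma has_sum_even_overpartitions:
  fixes t q :: complex
  assumes "norm t \<le> 1" "norm q < 1"
  shows "((\<lambda>\<mu>. t ^ size (fst \<mu>) * q ^ sum_mset (fst \<mu>)) has_sum
    (\<Prod>i<m. (1 + t * q ^ (2 * i + 2)) / (1 - t * q ^ (2 * i + 2)))) (even_overpartitions m)"
proof (induction m)
  case 0
  then show ?case by (simp add: even_overpartitions_0 has_sum_finite_iff)
next
  case (Suc m)
  define p where "p = 2 * m + 2"
  define z where "z = t * q ^ p"
  have z: "norm z < 1"
  proof -
    have "norm t * norm q ^ p \<le> 1 * norm q ^ p"
      using assms by (intro mult_right_mono) auto
    moreover have "norm q ^ p \<le> norm q ^ 1"
      using assms by (intro power_decreasing) (auto simp: p_def)
    ultimately show ?thesis using assms by (simp add: z_def norm_mult norm_power)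
  qed
  \<comment> \<open>Multiplicity of the new part together with its overline flag, which requires
    multiplicity at least 1; the two halves sum to 1/(1-z) and z/(1-z).\<close>
  define B where "B = range (\<lambda>k::nat. (k, False)) \<union> (\<lambda>k. (k, True)) ` {1..}"
  have "((\<lambda>(k, b). z ^ k) has_sum 1 / (1 - z)) (range (\<lambda>k::nat. (k, False)))"
    by (subst has_sum_reindex) (auto simp: inj_on_def o_def intro: has_sum_geometric_complex z)
  moreover have "((\<lambda>(k, b). z ^ k) has_sum z / (1 - z)) ((\<lambda>k::nat. (k, True)) ` {1..})"
    by (subst has_sum_reindex) (use has_sum_geometric_from_1[OF z] in \<open>auto simp: inj_on_def o_def\<close>)
  ultimately have "((\<lambda>(k, b). z ^ k) has_sum 1 / (1 - z) + z / (1 - z)) B"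
    unfolding B_def by (rule has_sum_Un_disjoint) auto
  then have B: "((\<lambda>(k, b). z ^ k) has_sum (1 + z) / (1 - z)) B"
    by (simp add: add_divide_distrib)
  have "((\<lambda>\<mu>. t ^ size (fst \<mu>) * q ^ sum_mset (fst \<mu>)) has_sum
      (\<Prod>i<m. (1 + t * q ^ (2 * i + 2)) / (1 - t * q ^ (2 * i + 2))) * ((1 + z) / (1 - z)))
      (even_overpartitions (Suc m))"
  proof (rule has_sum_reindex_bij_witness[THEN iffD2, OF _ _ _ _ _ refl has_sum_Times_mult[OF Suc B]])
    let ?i = "\<lambda>((P, T), (k, b)). (P + replicate_mset k p, if b then insert p T else T)"
    let ?j = "\<lambda>(P, T). ((filter_mset (\<lambda>k. k \<noteq> p) P, T - {p}), (count P p, p \<in> T))"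
    show "?i (?j \<mu>) = \<mu>" for \<mu>
      by (auto simp: add_filter_replicate_mset split: prod.split)
    show "?j \<mu> \<in> even_overpartitions m \<times> B" if "\<mu> \<in> even_overpartitions (Suc m)" for \<mu>
    proof -
      obtain P T where \<mu>: "\<mu> = (P, T)" by force
      have "k \<le> 2 * m" if "k \<in># P" "k \<noteq> p" for k
      proof -
        have "even k" "k \<le> 2 * m + 2"
          using that \<open>\<mu> \<in> _\<close> by (auto simp: \<mu> even_overpartitions_def)
        then show ?thesis using that unfolding p_def by presburger
      qed
      moreover have "(count P p, p \<in> T) \<in> B"
        using that by (auto simp: \<mu> B_def even_overpartitions_def is_overpartition_def image_iff Suc_le_eq)
      ultimately show ?thesis
        using that by (auto simp: \<mu> even_overpartitions_def is_overpartition_def is_partition_def)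
    qed
    show "?j (?i v) = v" if "v \<in> even_overpartitions m \<times> B" for v
    proof -
      obtain P T k b where v: "v = ((P, T), (k, b))" by (metis surj_pair)
      have "p \<notin># P"
        using that by (auto simp: v even_overpartitions_def p_def)
      moreover from this have "p \<notin> T"
        using that by (auto simp: v even_overpartitions_def is_overpartition_def)
      moreover have "filter_mset (\<lambda>k. k \<noteq> p) (replicate_mset k p) = {#}"
        by (rule multiset_eqI) auto
      ultimately show ?thesis
        by (auto simp: v count_eq_0_filter not_in_iff)
    qed
    show "?i v \<in> even_overpartitions (Suc m)" if "v \<in> even_overpartitions m \<times> B" for v
    proof -
      obtain P T k b where v: "v = ((P, T), (k, b))" by (metis surj_pair)
      have "b \<Longrightarrow> k > 0" and "even p" "p \<le> 2 * Suc m" "p \<noteq> 0"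
        using that by (auto simp: v B_def p_def)
      then show ?thesis
        using that by (auto simp: v even_overpartitions_def is_overpartition_def is_partition_def)
    qed
    show "(case ?j \<mu> of (u, v) \<Rightarrow> t ^ size (fst u) * q ^ sum_mset (fst u) * (case v of (k, b) \<Rightarrow> z ^ k)) =
        t ^ size (fst \<mu>) * q ^ sum_mset (fst \<mu>)" for \<mu>
    proof -
      obtain P T where \<mu>: "\<mu> = (P, T)" by force
      let ?F = "filter_mset (\<lambda>k. k \<noteq> p) P"
      have "size P = size ?F + count P p"
        using arg_cong[OF add_filter_replicate_mset[of p P], of size] by simp
      moreover have "sum_mset P = sum_mset ?F + count P p * p"
        using arg_cong[OF add_filter_replicate_mset[of p P], of sum_mset] by (simp add: sum_mset_replicate_nat)
      ultimately show ?thesis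
        by (simp add: \<mu> z_def power_mult_distrib power_add mult.commute flip: power_mult)
    qed
  qed
  then show ?case by (simp add: z_def p_def)
qed

lemma odd_partitions_below_0: "odd_partitions_below 0 = {{#}}"
proof -
  have "{k::nat. odd k \<and> k < 2 * 0 + 1} = {}" by (auto simp: odd_pos)
  then show ?thesis unfolding odd_partitions_below_def by (simp only:) auto
qed

text \<open>A multiset containing p splits uniquely into its other parts and the multiplicity of p,
  so sums over the two components multiply.\<close>

lemma has_sum_add_part:
  fixes q :: complex
  assumes A: "((\<lambda>L. q ^ sum_mset L) has_sum a) A" and K: "((\<lambda>k. q ^ (k * p)) has_sum b) K"
    and p: "\<And>L. L \<in> A \<Longrightarrow> p \<notin># L"
    and L: "\<And>L. L \<in> A' \<longleftrightarrow> filter_mset (\<lambda>k. k \<noteq> p) L \<in> A \<and> count L p \<in> K"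
  shows "((\<lambda>L. q ^ sum_mset L) has_sum a * b) A'"
proof (rule has_sum_reindex_bij_witness[THEN iffD2, OF _ _ _ _ _ refl has_sum_Times_mult[OF A K]])
  let ?i = "\<lambda>(L, k). L + replicate_mset k p"
  let ?j = "\<lambda>L. (filter_mset (\<lambda>k. k \<noteq> p) L, count L p)"
  have filt: "filter_mset (\<lambda>k. k \<noteq> p) (replicate_mset k p) = {#}" for k
    by (rule multiset_eqI) auto
  show "?i (?j M) = M" for M by (simp add: add_filter_replicate_mset)
  show "?j M \<in> A \<times> K" if "M \<in> A'" for M using that L by simp
  show *: "?j (?i v) = v" if "v \<in> A \<times> K" for v
    using that p by (auto simp: count_eq_0_filter filt not_in_iff)
  show "?i v \<in> A'" if "v \<in> A \<times> K" for v
    using *[OF that] that by (auto simp: L)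
  show "(case ?j M of (u, v) \<Rightarrow> q ^ sum_mset u * q ^ (v * p)) = q ^ sum_mset M" for M
    using arg_cong[OF add_filter_replicate_mset[of p M], of sum_mset]
    by (simp add: sum_mset_replicate_nat flip: power_add)
qed

lemma has_sum_odd_partitions_below:
  fixes q :: complex
  assumes "norm q < 1"
  shows "((\<lambda>L. q ^ sum_mset L) has_sum (\<Prod>i<m. q ^ (4 * i + 2) / (1 - q ^ (4 * i + 2)))) (odd_partitions_below m)"
proof (induction m)
  case 0
  then show ?case by (simp add: odd_partitions_below_0 has_sum_finite_iff)
next
  case (Suc m)
  define p where "p = 2 * m + 1"
  define K where "K = {k. even k \<and> k > (0::nat)}"
  \<comment> \<open>Positive even multiplicities 2i of p give the powers z^i with i >= 1.\<close>
  define z where "z = q ^ (2 * p)"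
  have z: "norm z < 1"
    unfolding z_def norm_power using assms by (subst power_less_one_iff) (auto simp: p_def)
  have "((\<lambda>k. q ^ (k * p)) has_sum z / (1 - z)) K"
  proof (rule has_sum_reindex_bij_witness[THEN iffD2, OF _ _ _ _ _ refl has_sum_geometric_from_1[OF z]])
    show "2 * (k div 2) = k" "k div 2 \<in> {1..}" if "k \<in> K" for k
      using that by (auto simp: K_def elim!: evenE)
    show "z ^ (k div 2) = q ^ (k * p)" if "k \<in> K" for k
    proof -
      obtain i where "k = 2 * i" using \<open>k \<in> K\<close> by (auto simp: K_def)
      then show ?thesis by (simp add: z_def ac_simps flip: power_mult)
    qed
  qed (auto simp: K_def)
  from has_sum_add_part[OF Suc this]
  have "((\<lambda>L. q ^ sum_mset L) has_sum (\<Prod>i<m. q ^ (4 * i + 2) / (1 - q ^ (4 * i + 2))) * (z / (1 - z)))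
      (odd_partitions_below (Suc m))"
  proof this
    show "p \<notin># L" if "L \<in> odd_partitions_below m" for L
      using that by (auto simp: odd_partitions_below_def p_def)
    show "L \<in> odd_partitions_below (Suc m) \<longleftrightarrow>
        filter_mset (\<lambda>k. k \<noteq> p) L \<in> odd_partitions_below m \<and> count L p \<in> K" (is "?l \<longleftrightarrow> ?r") for L
    proof -
      let ?O = "\<lambda>m. {k. odd k \<and> k < 2 * m + 1}"
      have O: "?O (Suc m) = insert p (?O m)" "p \<notin> ?O m"
        unfolding p_def by (auto; presburger)+
      have "(\<forall>k. even (count L k)) \<longleftrightarrow> (\<forall>k. even (count (filter_mset (\<lambda>k. k \<noteq> p) L) k)) \<and> even (count L p)"
        by auto
      moreover have "set_mset L = ?O (Suc m) \<longleftrightarrow> set_mset (filter_mset (\<lambda>k. k \<noteq> p) L) = ?O m \<and> p \<in># L"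
        using O(2) unfolding O(1) set_mset_filter by blast
      ultimately show ?thesis
        unfolding odd_partitions_below_def K_def by auto
    qed
  qed
  moreover have "2 * p = 4 * m + 2" by (simp add: p_def)
  ultimately show ?case by (simp add: z_def)
qed

lemma has_sum_odd_partitions:
  fixes q :: complex
  assumes "norm q < 1"
  shows "((\<lambda>L. q ^ sum_mset L) has_sum
    (\<Prod>i<m. q ^ (4 * i + 2) / (1 - q ^ (4 * i + 2))) * (1 / (1 - q ^ (2 * m + 1)))) (odd_partitions m)"
proof (rule has_sum_add_part[OF has_sum_odd_partitions_below[OF assms]])
  let ?p = "2 * m + 1"
  have "norm (q ^ ?p) < 1"
    unfolding norm_power using assms by (subst power_less_one_iff) auto
  from has_sum_geometric_complex[OF this]
  show "((\<lambda>k. q ^ (k * ?p)) has_sum 1 / (1 - q ^ ?p)) UNIV"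
    by (simp add: mult.commute flip: power_mult del: power_Suc)
  show "?p \<notin># L" if "L \<in> odd_partitions_below m" for L
    using that by (auto simp: odd_partitions_below_def)
  show "L \<in> odd_partitions m \<longleftrightarrow> filter_mset (\<lambda>k. k \<noteq> ?p) L \<in> odd_partitions_below m \<and> count L ?p \<in> UNIV" for L
    by (simp add: odd_partitions_def)
qed

section \<open>The generating function for fixed m and the left-hand side\<close>

definition Q_gf :: "complex \<Rightarrow> complex \<Rightarrow> nat \<Rightarrow> complex" where
  "Q_gf t q m = (\<Prod>i<m. (1 + t * q ^ (2 * i + 2)) / (1 - t * q ^ (2 * i + 2))) *
     ((\<Prod>i<m. q ^ (4 * i + 2) / (1 - q ^ (4 * i + 2))) * (1 / (1 - q ^ (2 * m + 1))))"

text \<open>At t = -1 this carries the sign of the theorem; at t = 1 with \<open>norm q\<close> in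
  place of \<open>q\<close> it is the absolute value of that weight.\<close>

definition weight :: "complex \<Rightarrow> complex \<Rightarrow> (nat multiset \<times> nat set) \<times> nat multiset \<Rightarrow> complex" where
  "weight t q p = t ^ size (fst (fst p)) * q ^ (sum_mset (fst (fst p)) + sum_mset (snd p))"

lemma has_sum_weight:
  assumes "norm t \<le> 1" "norm q < 1"
  shows "(weight t q has_sum Q_gf t q m) (even_overpartitions m \<times> odd_partitions m)"
  using has_sum_Times_mult[OF has_sum_even_overpartitions[OF assms] has_sum_odd_partitions[OF assms(2)]]
  unfolding Q_gf_def by (simp add: weight_def[abs_def] power_add case_prod_unfold mult.assoc)

text \<open>All 2m + 1 denominators are at least 1 - r, and r^(4i+2) <= r^(i+1) turns the numerators
  into a triangular power.\<close>

lemma norm_Q_gf_le: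
  fixes r :: real
  assumes "0 \<le> r" "r < 1"
  shows "norm (Q_gf 1 (of_real r) m) \<le> 1 / (1 - r) * ((2 / (1 - r)\<^sup>2) ^ m * r ^ (Suc m choose 2))"
proof -
  have frac: "norm (a / (1 - of_real r ^ k :: complex)) \<le> c / (1 - r)" if "k > 0" "norm a \<le> c" for a k c
  proof -
    have "r ^ k \<le> r ^ 1" using assms that by (intro power_decreasing) auto
    moreover have "norm (1 - of_real r ^ k :: complex) = \<bar>1 - r ^ k\<bar>"
      by (metis norm_of_real of_real_1 of_real_diff of_real_power)
    ultimately have "1 - r \<le> norm (1 - of_real r ^ k :: complex)" by simp
    then show ?thesis
      unfolding norm_divide using assms that order_trans[OF norm_ge_zero that(2)]
      by (intro frac_le) auto
  qed
  have p: "norm (of_real r ^ k :: complex) \<le> 1" for k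
    using assms by (simp add: norm_power power_le_one)
  have "norm ((1 + of_real r ^ (2 * i + 2)) / (1 - of_real r ^ (2 * i + 2)) :: complex) \<le> 2 / (1 - r)" for i
    using norm_triangle_ineq[of 1 "of_real r ^ (2 * i + 2) :: complex"] p[of "2 * i + 2"] by (intro frac) auto
  then have "norm (\<Prod>i<m. (1 + of_real r ^ (2 * i + 2)) / (1 - of_real r ^ (2 * i + 2)) :: complex) \<le> (\<Prod>i<m. 2 / (1 - r))"
    unfolding prod_norm[symmetric] by (intro prod_mono) auto
  moreover have "norm (\<Prod>i<m. of_real r ^ (4 * i + 2) / (1 - of_real r ^ (4 * i + 2)) :: complex) \<le> (\<Prod>i<m. r ^ Suc i / (1 - r))"
    unfolding prod_norm[symmetric]
  proof (intro prod_mono conjI norm_ge_zero frac)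
    show "norm (of_real r ^ (4 * i + 2) :: complex) \<le> r ^ Suc i" for i
      unfolding norm_power using assms by (simp only: norm_of_real abs_of_nonneg) (intro power_decreasing, auto)
  qed simp
  moreover have "norm (1 / (1 - of_real r ^ (2 * m + 1)) :: complex) \<le> 1 / (1 - r)"
    by (rule frac) auto
  ultimately have "norm (Q_gf 1 (of_real r) m) \<le> (\<Prod>i<m. 2 / (1 - r)) * ((\<Prod>i<m. r ^ Suc i / (1 - r)) * (1 / (1 - r)))"
    unfolding Q_gf_def norm_mult mult_1 using assms
    by (intro mult_mono) (auto intro!: prod_nonneg mult_nonneg_nonneg)
  also have "(\<Prod>i<m. r ^ Suc i / (1 - r)) = r ^ (Suc m choose 2) / (1 - r) ^ m"
    by (induction m) (simp_all add: Suc_choose_two[of "Suc _"] power_add binomial_eq_0 ac_simps)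
  finally show ?thesis
    by (simp add: power_divide power2_eq_square power_mult_distrib ac_simps)
qed

text \<open>Since 1 + x^i = (1 - x^(2i)) / (1 - x^i), the even factors of
  \<open>qpoch (2 * m)\<close> arise from the overpartitions and the odd ones from the odd parts;
  x^(m^2) comes from the sum of the first m odd numbers.\<close>

lemma (in punctured_disc) Q_gf_eq:
  assumes q: "q\<^sup>2 = x"
  shows "Q_gf (-1) q m = x ^ m\<^sup>2 * (1 + q * x ^ m) * (qpoch m)\<^sup>2 / qpoch (2 * m + 1)"
proof -
  have qe: "q ^ (2 * i + 2) = x ^ Suc i" "q ^ (4 * i + 2) = x ^ Suc (2 * i)" for i
    unfolding q[symmetric] by (simp_all flip: power_mult power_Suc add: algebra_simps)
  have H: "(\<Prod>i<m. (1 - x ^ Suc i) / (1 + x ^ Suc i)) * (\<Prod>i<m. x ^ Suc (2 * i) / (1 - x ^ Suc (2 * i))) =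
      x ^ m\<^sup>2 * (qpoch m)\<^sup>2 / qpoch (2 * m)"
  proof (induction m)
    case (Suc m)
    define y c where "y = x ^ Suc m" and "c = x ^ Suc (2 * m)"
    have yy: "x ^ Suc (Suc (2 * m)) = y * y"
      by (simp add: y_def flip: power_add power_Suc) (simp add: mult_2)
    have "1 - y * y \<noteq> 0" and c: "1 - c \<noteq> 0"
      unfolding yy[symmetric] c_def by (rule one_minus_power_nz)+
    moreover have "1 - y * y = (1 - y) * (1 + y)" by (simp add: algebra_simps)
    ultimately have y: "1 - y \<noteq> 0" "1 + y \<noteq> 0" by auto
    have sq: "x ^ (Suc m)\<^sup>2 = x ^ m\<^sup>2 * c"
      unfolding c_def power_add[symmetric]
      by (rule arg_cong[of _ _ "\<lambda>k. x ^ k"]) (simp add: power2_eq_square)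
    have P2: "qpoch (2 * Suc m) = qpoch (2 * m) * (1 - c) * ((1 - y) * (1 + y))"
      by (simp add: qpoch_Suc c_def yy[simplified] \<open>1 - y * y = _\<close>[symmetric])
    have P1: "qpoch (Suc m) = qpoch m * (1 - y)" by (simp only: qpoch_Suc y_def)
    have pr: "(\<Prod>i<Suc m. (1 - x ^ Suc i) / (1 + x ^ Suc i)) * (\<Prod>i<Suc m. x ^ Suc (2 * i) / (1 - x ^ Suc (2 * i))) =
        (x ^ m\<^sup>2 * (qpoch m)\<^sup>2 / qpoch (2 * m)) * ((1 - y) / (1 + y) * (c / (1 - c)))"
      unfolding Suc[symmetric] prod.lessThan_Suc y_def c_def by (simp only: mult_ac)
    show ?case
      unfolding pr sq P2 P1
      using y c by (simp add: divide_simps power2_eq_square)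
  qed simp
  \<comment> \<open>Expanding the last factor 1/(1 - v) by 1 + v completes
    \<open>qpoch (2 * m + 1)\<close> and creates the factor 1 + q x^m.\<close>
  define v where "v = q * x ^ m"
  have v: "q ^ (2 * m + 1) = v"
    by (simp add: v_def power_mult q)
  have vv: "x ^ Suc (2 * m) = v * v"
    by (simp add: v_def q[symmetric] flip: power_mult power_Suc power_add)
  have "1 - v * v \<noteq> 0" unfolding vv[symmetric] by (rule one_minus_power_nz)
  moreover have fac: "1 - v * v = (1 - v) * (1 + v)" by (simp add: algebra_simps)
  ultimately have v0: "1 - v \<noteq> 0" "1 + v \<noteq> 0" by auto
  have "Q_gf (-1) q m = x ^ m\<^sup>2 * (qpoch m)\<^sup>2 / qpoch (2 * m) * (1 / (1 - v))"
    unfolding Q_gf_def qe v H[symmetric] by (simp add: mult.assoc)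
  also have "\<dots> = x ^ m\<^sup>2 * (1 + v) * (qpoch m)\<^sup>2 / (qpoch (2 * m) * ((1 - v) * (1 + v)))"
    using v0 by simp
  also have "qpoch (2 * m) * ((1 - v) * (1 + v)) = qpoch (2 * m + 1)"
    by (simp only: fac[symmetric] vv[symmetric] qpoch_Suc Suc_eq_plus1[symmetric])
  finally show ?thesis by (simp add: v_def)
qed

text \<open>One absolutely summable family over all m and all pairs is summed twice: by m, giving
  \<open>Q_gf\<close>, and by the triples (m, n, j), whose fibres are the finite sets
  \<open>Q_pairs\<close>.\<close>

lemma has_sum_Q:
  fixes q :: complex
  assumes q: "norm q < 1" and S: "(\<lambda>m. Q_gf (-1) q m) sums S"
  shows "((\<lambda>(m, n, j). (-1) ^ j * of_nat (Q m j n) * q ^ n) has_sum S) (UNIV :: (nat \<times> nat \<times> nat) set)"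
proof -
  let ?Z = "SIGMA m:UNIV. even_overpartitions m \<times> odd_partitions m"
  let ?W = "\<lambda>(m::nat, p). weight (-1) q p"
  have "(\<lambda>z. norm (?W z)) summable_on ?Z"
  proof (rule summable_on_SigmaI)
    fix m
    have "complex_of_real (norm (weight (-1) q p)) = weight 1 (of_real (norm q)) p" for p
      by (simp add: weight_def norm_mult norm_power)
    then have "((\<lambda>p. complex_of_real (norm (weight (-1) q p))) has_sum Q_gf 1 (of_real (norm q)) m)
        (even_overpartitions m \<times> odd_partitions m)"
      using has_sum_weight[of 1 "of_real (norm q)" m] q by simp
    from has_sum_Re[OF this]
    show "((\<lambda>p. norm (?W (m, p))) has_sum Re (Q_gf 1 (of_real (norm q)) m)) (even_overpartitions m \<times> odd_partitions m)"
      by simp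
  next
    have "summable (\<lambda>m. 1 / (1 - norm q) * ((2 / (1 - norm q)\<^sup>2) ^ m * norm q ^ (Suc m choose 2)))"
      using q by (intro summable_mult summable_power_triangular) auto
    moreover have "norm (norm (Re (Q_gf 1 (of_real (norm q)) m))) \<le>
        1 / (1 - norm q) * ((2 / (1 - norm q)\<^sup>2) ^ m * norm q ^ (Suc m choose 2))" for m
      using abs_Re_le_cmod[of "Q_gf 1 (of_real (norm q)) m"] norm_Q_gf_le[of "norm q" m] q by simp
    ultimately have "summable (\<lambda>m. norm (Re (Q_gf 1 (of_real (norm q)) m)))"
      by (blast intro: summable_comparison_test')
    then show "(\<lambda>m. Re (Q_gf 1 (of_real (norm q)) m)) summable_on UNIV"
      by (rule norm_summable_imp_summable_on)
  qed auto
  then have "?W summable_on ?Z"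
    by (rule Infinite_Sum.abs_summable_summable)
  then obtain T where T: "(?W has_sum T) ?Z"
    by (auto simp: summable_on_def)
  have "((\<lambda>m. Q_gf (-1) q m) has_sum T) UNIV"
    by (rule has_sum_SigmaD[OF T]) (use has_sum_weight[of "-1" q] q in simp)
  then have "T = S"
    using S has_sum_imp_sums sums_unique2 by blast
  let ?Y = "SIGMA (m, n, j):UNIV. Q_pairs m j n"
  have "((\<lambda>(u, p). weight (-1) q p) has_sum S) ?Y"
  \<comment> \<open>n and j are functions of the pair, so recording them in the index is a bijective
    relabelling.\<close>
  proof (rule has_sum_reindex_bij_witness[THEN iffD2, OF _ _ _ _ _ refl T[unfolded \<open>T = S\<close>]])
    let ?j = "\<lambda>((m, n, j), p). (m, p)"
    let ?i = "\<lambda>(m, p). ((m, sum_mset (fst (fst p)) + sum_mset (snd p), size (fst (fst p))), p)"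
    show "?i (?j z) = z" if "z \<in> ?Y" for z using that by (auto simp: Q_pairs_eq)
    show "?j z \<in> ?Z" if "z \<in> ?Y" for z using that by (auto simp: Q_pairs_eq)
    show "?j (?i z) = z" for z by (simp add: case_prod_unfold)
    show "?i z \<in> ?Y" if "z \<in> ?Z" for z using that by (auto simp: Q_pairs_eq)
    show "?W (?j z) = (case z of (u, p) \<Rightarrow> weight (-1) q p)" for z by (auto split: prod.split)
  qed
  then show ?thesis
  proof (rule has_sum_SigmaD)
    fix u :: "nat \<times> nat \<times> nat"
    obtain m n j where u: "u = (m, n, j)" by (metis surj_pair)
    have "(\<Sum>p\<in>Q_pairs m j n. weight (-1) q p) = (\<Sum>p\<in>Q_pairs m j n. (-1) ^ j * q ^ n)"
      by (intro sum.cong) (auto simp: Q_pairs_eq weight_def)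
    also have "\<dots> = (-1) ^ j * of_nat (Q m j n) * q ^ n"
      by (simp add: Q_def)
    finally show "((\<lambda>p. case (u, p) of (u, p) \<Rightarrow> weight (-1) q p) has_sum
        (case u of (m, n, j) \<Rightarrow> (-1) ^ j * of_nat (Q m j n) * q ^ n)) (case u of (m, n, j) \<Rightarrow> Q_pairs m j n)"
      using has_sum_finite[OF finite_Q_pairs[of m j n], of "weight (-1) q"] by (simp add: u)
  qed
qed

theorem theorem1p2:
  fixes q s :: complex
  assumes "0 < norm q" and "norm q < 1" and "s\<^sup>2 = q"
  shows "(\<lambda>(m, n, j). (-1) ^ j * of_nat (Q m j n) * q ^ n) summable_on (UNIV :: (nat \<times> nat \<times> nat) set)
    \<and> summable (rhs_term1 q s)
    \<and> summable (rhs_term2 q s)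
    \<and> (\<Sum>\<^sub>\<infinity>(m, n, j)\<in>UNIV. (-1) ^ j * of_nat (Q m j n) * q ^ n)
        = 1 / 2 * (\<Sum>n. rhs_term1 q s n) + 1 / 2 * (\<Sum>n. rhs_term2 q s n)"
proof -
  define x where "x = q\<^sup>2"
  have x4: "x = s ^ 4" using assms(3) by (auto simp add: x_def simp flip: power_mult)
  interpret punctured_disc x
    using assms(1,2) by unfold_locales (auto simp: x_def norm_power power_less_one_iff)
  have "norm s ^ 2 < 1 ^ 2" using assms(2,3) by (metis norm_power one_power2)
  then have s: "norm s < 1" by (rule power_less_imp_less_base) simp
  have sm: "summable (rhs_term1 q s)" "summable (rhs_term2 q s)"
    using s assms(2) by (auto intro: summable_rhs_term1 summable_rhs_term2)
  \<comment> \<open>After rewriting both sides, the Bailey transform supplies one common limit for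
    the generating functions and for the averaged right-hand terms.\<close>
  obtain S where S: "(\<lambda>m. Q_gf (-1) q m) sums S"
    and S': "(\<lambda>n. (rhs_term1 q s n + rhs_term2 q s n) / 2) sums S"
    using sums_Bailey_transform[of q] assms(2)
    unfolding swapped_term_eq[OF assms(3)[symmetric] x4] Q_gf_eq[OF x_def[symmetric]] by auto
  have "S = ((\<Sum>n. rhs_term1 q s n) + (\<Sum>n. rhs_term2 q s n)) / 2"
    using sums_unique2[OF S' sums_divide[OF sums_add[OF summable_sums summable_sums]]] sm by blast
  then show ?thesis
    using has_sum_Q[OF assms(2) S] sm
    by (auto simp: summable_on_def infsumI add_divide_distrib)
qed

end
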